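(* For every integer $m\ge0$ and every $n\ge1$ there exists an injective map from $Q(m,n)$ to $P(-m,n)$.
   Context: For a partition $\lambda$ with parts $\lambda_1\ge\cdots\ge\lambda_\ell>0$, its rank is $\lambda_1-\ell$, and its rank-set is the infinite sequence $[-\lambda_1,1-\lambda_2,\dots,\ell-1-\lambda_\ell,\ell,\ell+1,\dots]$. $Q(m,n)$ is the set of partitions of $n$ in whose rank-set $m$ appears; $P(-m,n)$ is the set of partitions of $n$ with rank $\ge -m$. *)

theory Defs
  imports Main
begin

definition is_partition :: "nat list \<Rightarrow> nat \<Rightarrow> bool" where
  "is_partition lam n \<longleftrightarrow> sorted_wrt (\<ge>) lam \<and> (\<forall>x\<in>set lam. 0 < x) \<and> sum_list lam = n"

definition partitions :: "nat \<Rightarrow> nat list set" where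
  "partitions n = {lam. is_partition lam n}"

definition prank :: "nat list \<Rightarrow> int" where
  "prank lam = (if lam = [] then 0 else int (hd lam)) - int (length lam)"

text \<open>Rank-set [-lam_1, 1-lam_2, ..., l-1-lam_l, l, l+1, ...] as a set of integers
  (0-based index i gives entry i - lam!i; then all integers \<ge> l).\<close>
definition rank_set :: "nat list \<Rightarrow> int set" where
  "rank_set lam = {int i - int (lam ! i) | i. i < length lam} \<union> {k. int (length lam) \<le> k}"

definition Q :: "int \<Rightarrow> nat \<Rightarrow> nat list set" where
  "Q m n = {lam \<in> partitions n. m \<in> rank_set lam}"

definition P :: "int \<Rightarrow> nat \<Rightarrow> nat list set" where
  "P r n = {lam \<in> partitions n. r \<le> prank lam}"

end

(* The common elements of the two sets do not matter, so Q - P is compared with P - Q.  Decomposing along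
   the m-Durfee rectangle, these two differences have generating functions that are sums over (a, s)
   of a power of q times two Gaussian binomials.  Pascal's rule cancels most of the two sums against
   each other.  For m >= 1 the rest is compared term by term with q-log-concavity, which is proved
   by the Lindstrom-Gessel-Viennot determinant.  For m = 0 the sum over s has to be taken first:
   Heine's transformation turns it into a polynomial over (1 - q^2)...(1 - q^c), and a reflection
   argument shows that the numerator is (1 - q^3) A + B, where A and B are sums of q-log-concavity
   differences. *)

theory Submission
  imports Defs "HOL-Computational_Algebra.Formal_Power_Series"
begin

text \<open>The obstacle at m = 0 is that the terms left after cancellation cannot be compared one
  by one. Comparing s + 1 with s, as for m >= 1, fails at the lowest power of q for a >= 1.
  Comparing equal s fails too: for a = 2 and s = 0 the difference is a power of q times 1 - q^3.
  Negative coefficients disappear only after summation over s, where the factor 1 - q^3 of the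
  numerator is absorbed by the same factor of the denominator. The injection itself is never
  constructed. A map covering Q - P, an injection into P - Q and a coefficient inequality between
  the numbers of codes compare the cardinalities.\<close>

unbundle fps_syntax

section \<open>Series with nonnegative coefficients\<close>

definition fps_nonneg :: "int fps \<Rightarrow> bool" where
  "fps_nonneg f \<longleftrightarrow> (\<forall>n. 0 \<le> f $ n)"

lemma fps_nonneg_0 [simp]: "fps_nonneg 0"
  and fps_nonneg_1 [simp]: "fps_nonneg 1"
  and fps_nonneg_X [simp]: "fps_nonneg fps_X"
  by (auto simp: fps_nonneg_def fps_X_def)

lemma fps_nonneg_add: "fps_nonneg f \<Longrightarrow> fps_nonneg g \<Longrightarrow> fps_nonneg (f + g)"
  by (auto simp: fps_nonneg_def)

lemma fps_nonneg_mult: "fps_nonneg f \<Longrightarrow> fps_nonneg g \<Longrightarrow> fps_nonneg (f * g)"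
  by (auto simp: fps_nonneg_def fps_mult_nth intro!: sum_nonneg)

lemma fps_nonneg_power [simp]: "fps_nonneg f \<Longrightarrow> fps_nonneg (f ^ k)"
  by (induction k) (auto intro: fps_nonneg_mult)

lemma fps_nonneg_trans: "fps_nonneg (h - g) \<Longrightarrow> fps_nonneg (g - f) \<Longrightarrow> fps_nonneg (h - f)"
  using fps_nonneg_add[of "h - g" "g - f"] by simp

lemma fps_nonneg_mult_mono:
  assumes "fps_nonneg (f' - f)" "fps_nonneg (g' - g)" "fps_nonneg f" "fps_nonneg g'"
  shows "fps_nonneg (f' * g' - f * g)"
proof -
  have "f' * g' - f * g = (f' - f) * g' + f * (g' - g)"
    by (simp add: algebra_simps)
  thus ?thesis using assms by (simp add: fps_nonneg_add fps_nonneg_mult)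
qed

lemma fps_X_power_numeral_mult:
  "(fps_X :: int fps) ^ (numeral v * k) = (fps_X ^ k) ^ numeral v"
  by (metis mult.commute power_mult)

abbreviation q :: "int fps" where "q \<equiv> fps_X"

text \<open>Powers of q become products of powers with atomic exponents, so that identities between
  monomials reduce to polynomial identities.\<close>

lemmas qpow = fps_X_power_numeral_mult power_add power_Suc

section \<open>Locally finite sums of power series\<close>

definition fps_small :: "(nat \<Rightarrow> int fps) \<Rightarrow> bool" where
  "fps_small f \<longleftrightarrow> (\<forall>i. \<forall>n<i. f i $ n = 0)"

text \<open>The sum of a sequence whose \<open>i\<close>-th term is divisible by \<open>q ^ i\<close>, so that the truncation is exact.\<close>
definition fsum :: "(nat \<Rightarrow> int fps) \<Rightarrow> int fps" where
  "fsum f = Abs_fps (\<lambda>n. \<Sum>i\<le>n. f i $ n)"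

lemma fsum_nth: "fsum f $ n = (\<Sum>i\<le>n. f i $ n)"
  by (simp add: fsum_def)

lemma fps_smallI: "(\<And>i. f i = q ^ (k i) * g i) \<Longrightarrow> (\<And>i. i \<le> k i) \<Longrightarrow> fps_small f"
  unfolding fps_small_def
  by (simp add: fps_X_power_mult_nth) (meson less_le_trans)

lemma fps_small_add: "fps_small f \<Longrightarrow> fps_small g \<Longrightarrow> fps_small (\<lambda>i. f i + g i)"
  by (auto simp: fps_small_def)

lemma fps_small_diff: "fps_small f \<Longrightarrow> fps_small g \<Longrightarrow> fps_small (\<lambda>i. f i - g i)"
  by (auto simp: fps_small_def)

lemma fps_small_mult: "fps_small f \<Longrightarrow> fps_small (\<lambda>i. f i * g i)"
  by (auto simp: fps_small_def fps_mult_nth)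

lemma fsum_add: "fsum (\<lambda>i. f i + g i) = fsum f + fsum g"
  by (rule fps_ext) (simp add: fsum_nth sum.distrib)

lemma fsum_diff: "fsum (\<lambda>i. f i - g i) = fsum f - fsum g"
  by (rule fps_ext) (simp add: fsum_nth sum_subtractf)

lemma fsum_Suc:
  assumes "fps_small f"
  shows "fsum f = f 0 + fsum (\<lambda>i. f (Suc i))"
proof (rule fps_ext)
  fix n
  have "(\<Sum>i\<le>Suc n. f i $ n) = f 0 $ n + (\<Sum>i\<le>n. f (Suc i) $ n)"
    by (rule sum.atMost_Suc_shift)
  thus "fsum f $ n = (f 0 + fsum (\<lambda>i. f (Suc i))) $ n"
    using assms by (simp add: fsum_nth fps_small_def)
qed

lemma fsum_nth_le:
  assumes "fps_small f" "n \<le> N"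
  shows "fsum f $ n = (\<Sum>i\<le>N. f i $ n)"
  unfolding fsum_nth
  by (rule sum.mono_neutral_left) (use assms in \<open>auto simp: fps_small_def\<close>)

lemma fsum_cmult:
  assumes "fps_small f"
  shows "fsum (\<lambda>i. c * f i) = c * fsum f"
proof (rule fps_ext)
  fix n
  have "(c * fsum f) $ n = (\<Sum>k\<le>n. c $ k * (\<Sum>i\<le>n. f i $ (n - k)))"
    by (simp add: fps_mult_nth atMost_atLeast0 fsum_nth_le[OF assms, of _ n])
  also have "\<dots> = (\<Sum>i\<le>n. \<Sum>k\<le>n. c $ k * f i $ (n - k))"
    by (subst sum.swap) (simp add: sum_distrib_left)
  also have "\<dots> = fsum (\<lambda>i. c * f i) $ n"
    by (simp add: fsum_nth fps_mult_nth atMost_atLeast0)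
  finally show "fsum (\<lambda>i. c * f i) $ n = (c * fsum f) $ n" ..
qed

lemma fps_nonneg_fsum: "(\<And>i. fps_nonneg (f i)) \<Longrightarrow> fps_nonneg (fsum f)"
  by (auto simp: fps_nonneg_def fsum_nth intro!: sum_nonneg)

lemma fps_mult_nth_eq_0:
  assumes "\<And>n. n < i \<Longrightarrow> f $ n = (0::int)" "\<And>n. n < j \<Longrightarrow> g $ n = 0" "n < i + j"
  shows "(f * g) $ n = 0"
  unfolding fps_mult_nth
proof (rule sum.neutral, intro ballI)
  fix k assume "k \<in> {0..n}"
  hence "k < i \<or> n - k < j" using assms(3) by auto
  thus "f $ k * g $ (n - k) = 0" using assms(1,2) by auto
qed

text \<open>At coefficient n, the square k, r <= n can be cut down to the triangle k + r <= n
  because all other products vanish there; the triangle is then indexed by s = k + r.\<close>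

lemma fsum_mult:
  assumes f: "fps_small f" and g: "fps_small g"
  shows "fsum f * fsum g = fsum (\<lambda>s. \<Sum>k\<le>s. f k * g (s - k))"
proof (rule fps_ext)
  fix n
  have "(fsum f * fsum g) $ n = (\<Sum>k\<le>n. (f k * fsum g) $ n)"
    using fsum_cmult[OF f, of "fsum g"] by (simp add: mult.commute fsum_nth[symmetric])
  also have "\<dots> = (\<Sum>k\<le>n. \<Sum>r\<le>n. (f k * g r) $ n)"
    by (simp add: fsum_cmult[OF g, symmetric] fsum_nth)
  also have "\<dots> = (\<Sum>k\<le>n. \<Sum>r\<le>n - k. (f k * g r) $ n)"
  proof (rule sum.cong[OF refl], rule sum.mono_neutral_right)
    fix k assume "k \<in> {..n}"
    show "\<forall>r\<in>{..n} - {..n - k}. (f k * g r) $ n = 0"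
    proof
      fix r assume "r \<in> {..n} - {..n - k}"
      thus "(f k * g r) $ n = 0"
        using f g by (intro fps_mult_nth_eq_0[of k _ r]) (auto simp: fps_small_def)
    qed
  qed auto
  also have "\<dots> = (\<Sum>(k, r)\<in>(SIGMA k:{..n}. {..n - k}). (f k * g r) $ n)"
    by (simp add: sum.Sigma)
  also have "(SIGMA k:{..n}. {..n - k}) = {(k, r). k + r \<le> n}"
    by auto
  also have "(\<Sum>(k, r)\<in>{(k, r). k + r \<le> n}. (f k * g r) $ n)
      = (\<Sum>s\<le>n. \<Sum>k\<le>s. (f k * g (s - k)) $ n)"
    by (rule sum.triangle_reindex_eq)
  finally show "(fsum f * fsum g) $ n = fsum (\<lambda>s. \<Sum>k\<le>s. f k * g (s - k)) $ n"
    by (simp add: fsum_nth fps_sum_nth)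
qed

section \<open>Gaussian binomial coefficients\<close>

text \<open>\<open>G s c\<close> is the Gaussian binomial \<open>[s + c - 1, s]\<close>; the shift in \<open>c\<close> makes \<open>G s 0\<close> the value
  for a box of width \<open>-1\<close>, which keeps Pascal's rules free of side conditions.\<close>
fun G :: "nat \<Rightarrow> nat \<Rightarrow> int fps" where
  "G 0 c = 1"
| "G (Suc s) 0 = 0"
| "G (Suc s) (Suc c) = G (Suc s) c + q ^ c * G s (Suc c)"

lemma fps_nonneg_G [simp]: "fps_nonneg (G s c)"
  by (induction s c rule: G.induct) (auto intro!: fps_nonneg_add fps_nonneg_mult)

lemma G_1 [simp]: "G s (Suc 0) = 1"
  by (induction s) auto

text \<open>The recursion of \<open>G\<close> splits by whether the largest entry attains its bound
  c. This one splits by the smallest entry: a zero is dropped, otherwise 1 is subtracted from all s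
  + 1 entries.\<close>

lemma G_Suc': "G (Suc s) (Suc c) = G s (Suc c) + q ^ Suc s * G (Suc s) c"
proof (induction s c rule: G.induct)
  case (1 c)
  have "G 1 (Suc c) = 1 + q * G 1 c"
  proof (induction c)
    case (Suc c)
    have "G 1 (Suc (Suc c)) = G 1 (Suc c) + q * q ^ c" by simp
    also have "\<dots> = 1 + q * (G 1 c + q ^ c)" by (simp only: Suc.IH ring_distribs add.assoc)
    also have "G 1 c + q ^ c = G 1 (Suc c)" by simp
    finally show ?case .
  qed simp
  then show ?case by simp
next
  case (2 s)
  then show ?case by simp
next
  case (3 s c)
  have "G (Suc (Suc s)) (Suc (Suc c)) = G (Suc (Suc s)) (Suc c) + q ^ Suc c * G (Suc s) (Suc (Suc c))"
    by simp
  also have "\<dots> = (G (Suc s) (Suc c) + q ^ Suc (Suc s) * G (Suc (Suc s)) c)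
      + q ^ Suc c * (G s (Suc (Suc c)) + q ^ Suc s * G (Suc s) (Suc c))"
    using 3 by simp
  also have "\<dots> = G (Suc s) (Suc (Suc c)) + q ^ Suc (Suc s) * G (Suc (Suc s)) (Suc c)"
    by (simp add: algebra_simps)
  finally show ?case .
qed

text \<open>Conjugation of partitions in an a by b box. It exchanges the two Pascal rules, which
  makes the induction close.\<close>

lemma G_sym: "G a (Suc b) = G b (Suc a)"
proof (induction "a + b" arbitrary: a b)
  case 0
  then show ?case by simp
next
  case (Suc N)
  show ?case
  proof (cases "a = 0 \<or> b = 0")
    case True
    then show ?thesis by auto
  next
    case False
    then obtain a' b' where ab: "a = Suc a'" "b = Suc b'"
      by (meson not0_implies_Suc)
    have "G a (Suc b) = G a b + q ^ b * G a' (Suc b)"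
      by (simp add: ab)
    also have "G a b = G b' (Suc a)"
      using Suc(1)[of a b'] Suc(2) ab by simp
    also have "G a' (Suc b) = G b a"
      using Suc(1)[of a' b] Suc(2) ab by simp
    also have "G b' (Suc a) + q ^ b * G b a = G b (Suc a)"
      by (simp only: ab(2) G_Suc')
    finally show ?thesis .
  qed
qed

declare G.simps(3) [simp del]

section \<open>Lattice paths and log-concavity\<close>

text \<open>Generating function of the lattice paths from the origin to (x, y). Extended by zero to
  all integers, its recurrence fails only at the starting point.\<close>

definition Gz :: "int \<Rightarrow> int \<Rightarrow> int fps" where
  "Gz x y = (if x < 0 \<or> y < 0 then 0 else G (nat x) (Suc (nat y)))"

lemma Gz_nat [simp]: "Gz (int a) (int b) = G a (Suc b)"
  by (simp add: Gz_def)

lemma Gz_rec: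
  assumes "x \<noteq> 0 \<or> y \<noteq> 0"
  shows "Gz x y = q ^ nat y * Gz (x - 1) y + Gz x (y - 1)"
proof -
  consider "x < 0 \<or> y < 0" | "x = 0" "y > 0" | "x > 0" "y = 0" | "x > 0" "y > 0"
    using assms by linarith
  then show ?thesis
  proof cases
    case 4
    then obtain a b where ab: "x = 1 + int a" "y = 1 + int b"
      by (metis zero_less_imp_eq_int zle_iff_zadd zless_imp_add1_zle add_0)
    have "nat x = Suc a" "nat y = Suc b" "nat (x - 1) = a" "nat (y - 1) = b"
      using ab by auto
    then show ?thesis using 4 by (simp add: Gz_def G.simps(3))
  qed (auto simp: Gz_def)
qed

text \<open>The Lindstrom--Gessel--Viennot determinant of two lattice paths starting in \<open>(0, h)\<close> and
  \<open>(w, 0)\<close>, where a horizontal step at height \<open>y\<close> has weight \<open>q ^ y\<close>.\<close>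
lemma lattice_path_determinant_nonneg:
  fixes h w :: nat and x y x' y' :: int
  defines "P1 \<equiv> \<lambda>x y. q ^ (nat x * h) * Gz x (y - int h)"
    and "P2 \<equiv> \<lambda>x y. Gz (x - int w) y"
  assumes "x \<le> x'" "y' \<le> y"
  shows "fps_nonneg (P1 x y * P2 x' y' - P1 x' y' * P2 x y)"
  using assms(3,4)
proof (induction "nat x + nat y + nat x' + nat y'" arbitrary: x y x' y' rule: less_induct)
  case less
  have nonneg: "fps_nonneg (P1 a b)" "fps_nonneg (P2 a b)" for a b
    by (auto simp: P1_def P2_def Gz_def intro: fps_nonneg_mult)
  have zero: "P1 a b = 0" "P2 a b = 0" if "a < 0 \<or> b < 0" for a b
    using that by (auto simp: P1_def P2_def Gz_def)
  \<comment> \<open>\<open>P1\<close> raises a path from the origin by h, so each of its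
    \<open>nat a\<close> horizontal steps gains \<open>q ^ h\<close>; a last horizontal step then
    has weight \<open>q ^ nat b\<close>.\<close>
  have rec1: "P1 a b = q ^ nat b * P1 (a - 1) b + P1 a (b - 1)" if "(a, b) \<noteq> (0, int h)" "a \<ge> 0" "b \<ge> 0" for a b
  proof (cases "a = 0 \<or> b < int h")
    case True
    then show ?thesis using that Gz_rec[of a "b - int h"]
      by (auto simp: P1_def Gz_def)
  next
    case False
    have "nat a * h + nat (b - int h) = nat b + nat (a - 1) * h"
    proof -
      have "nat a = Suc (nat (a - 1))" "nat b = nat (b - int h) + h" using False that by auto
      then show ?thesis by simp
    qed
    hence weight: "q ^ (nat a * h) * q ^ nat (b - int h) = q ^ nat b * q ^ (nat (a - 1) * h)"
      by (simp only: power_add[symmetric])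
    have "P1 a b = q ^ (nat a * h) * (q ^ nat (b - int h) * Gz (a - 1) (b - int h) + Gz a (b - int h - 1))"
      unfolding P1_def using False Gz_rec[of a "b - int h"] by simp
    also have "\<dots> = (q ^ (nat a * h) * q ^ nat (b - int h)) * Gz (a - 1) (b - int h)
        + q ^ (nat a * h) * Gz a (b - int h - 1)"
      by (simp only: ring_distribs mult.assoc)
    also have "\<dots> = q ^ nat b * P1 (a - 1) b + P1 a (b - 1)"
      unfolding weight by (simp add: P1_def mult.assoc algebra_simps(3) diff_diff_eq add.commute)
    finally show ?thesis .
  qed
  have rec2: "P2 a b = q ^ nat b * P2 (a - 1) b + P2 a (b - 1)" if "(a, b) \<noteq> (int w, 0)" for a b
  proof -
    have "a - 1 - int w = a - int w - 1" by simp
    then show ?thesis using that Gz_rec[of "a - int w" b] by (simp only: P2_def) auto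
  qed
  consider "x < 0 \<or> y' < 0" | "0 \<le> x" "0 \<le> y'" "x = x'" "y = y'"
    | "0 \<le> x" "0 \<le> y'" "x < x'" | "0 \<le> x" "0 \<le> y'" "x = x'" "y' < y"
    using less.prems by linarith
  then show ?case
  proof cases
    case 1
    then show ?thesis using zero by auto
  next
    case 2
    then show ?thesis by simp
  next
    case 3
    consider "(x', y') = (0, int h)" | "(x', y') = (int w, 0)"
      | "(x', y') \<noteq> (0, int h)" "(x', y') \<noteq> (int w, 0)" by blast
    then show ?thesis
    proof cases
      case 1
      then show ?thesis using 3 by auto
    next
      case 2
      hence "P2 x y = 0" using 3 by (auto simp: P2_def Gz_def)
      then show ?thesis using nonneg by (simp add: fps_nonneg_mult)
    next
      case c: 3
      have "P1 x y * P2 x' y' - P1 x' y' * P2 x y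
          = q ^ nat y' * (P1 x y * P2 (x' - 1) y' - P1 (x' - 1) y' * P2 x y)
            + (P1 x y * P2 x' (y' - 1) - P1 x' (y' - 1) * P2 x y)"
        using 3 by (subst rec1[OF c(1)], simp, simp, subst rec2[OF c(2)]) (simp add: algebra_simps)
      moreover have "fps_nonneg (P1 x y * P2 (x' - 1) y' - P1 (x' - 1) y' * P2 x y)"
        by (rule less.hyps) (use 3 less.prems in auto)
      moreover have "fps_nonneg (P1 x y * P2 x' (y' - 1) - P1 x' (y' - 1) * P2 x y)"
      proof (cases "y' = 0")
        case True
        then show ?thesis using zero[of x' "y' - 1"] by simp
      next
        case False
        then show ?thesis by (intro less.hyps) (use 3 less.prems in auto)
      qed
      ultimately show ?thesis by (simp only:) (intro fps_nonneg_add fps_nonneg_mult fps_nonneg_power fps_nonneg_X)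
    qed
  next
    case 4
    consider "(x, y) = (0, int h)" | "(x, y) = (int w, 0)"
      | "(x, y) \<noteq> (0, int h)" "(x, y) \<noteq> (int w, 0)" by blast
    then show ?thesis
    proof cases
      case 1
      hence "P1 x' y' = 0" using 4 by (auto simp: P1_def Gz_def)
      then show ?thesis using nonneg by (simp add: fps_nonneg_mult)
    next
      case 2
      then show ?thesis using 4 by auto
    next
      case c: 3
      have "P1 x y * P2 x' y' - P1 x' y' * P2 x y
          = q ^ nat y * (P1 (x - 1) y * P2 x' y' - P1 x' y' * P2 (x - 1) y)
            + (P1 x (y - 1) * P2 x' y' - P1 x' y' * P2 x (y - 1))"
        using 4 by (subst rec1[OF c(1)], simp, simp, subst rec2[OF c(2)]) (simp add: algebra_simps)
      moreover have "fps_nonneg (P1 (x - 1) y * P2 x' y' - P1 x' y' * P2 (x - 1) y)"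
      proof (cases "x = 0")
        case True
        then show ?thesis using zero[of "x - 1" y] by simp
      next
        case False
        then show ?thesis by (intro less.hyps) (use 4 less.prems in auto)
      qed
      moreover have "fps_nonneg (P1 x (y - 1) * P2 x' y' - P1 x' y' * P2 x (y - 1))"
        by (rule less.hyps) (use 4 less.prems in auto)
      ultimately show ?thesis by (simp only:) (intro fps_nonneg_add fps_nonneg_mult fps_nonneg_power fps_nonneg_X)
    qed
  qed
qed

lemma fps_nonneg_X_power_mult:
  assumes "fps_nonneg (q ^ k * f)"
  shows "fps_nonneg f"
  unfolding fps_nonneg_def
proof
  fix n
  have "0 \<le> (q ^ k * f) $ (n + k)" using assms unfolding fps_nonneg_def ..
  thus "0 \<le> f $ n" by (simp add: fps_X_power_mult_nth)
qed

text \<open>The determinant with end points (x, y + h) and (x + u, y + h - v), after cancelling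
  \<open>q ^ (x * h)\<close>. Thus u and v are the offsets of the end points, w and h those of the
  starting points.\<close>

lemma Gz_log_concave:
  fixes u v w h :: nat
  shows "fps_nonneg (G x (Suc y) * Gz (int x + int u - int w) (int y - int v + int h)
    - q ^ (u * h) * (Gz (int x + int u) (int y - int v) * Gz (int x - int w) (int y + int h)))"
proof -
  define A B C where "A = Gz (int x + int u - int w) (int y - int v + int h)"
    and "B = Gz (int x + int u) (int y - int v)" and "C = Gz (int x - int w) (int y + int h)"
  have nat: "nat (int x + int u) = x + u" by simp
  have "int y + int h - int v = int y - int v + int h" "int y + int h - int h = int y"
    "int y - int v + int h - int h = int y - int v" by simp_all
  hence "fps_nonneg (q ^ (x * h) * G x (Suc y) * A - q ^ ((x + u) * h) * B * C)"
    using lattice_path_determinant_nonneg[of "int x" "int x + int u" "int y + int h - int v" "int y + int h" h w]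
    by (simp only: A_def B_def C_def nat nat_int Gz_nat)
  also have "q ^ (x * h) * G x (Suc y) * A - q ^ ((x + u) * h) * B * C
      = q ^ (x * h) * (G x (Suc y) * A - q ^ (u * h) * (B * C))"
    by (simp only: ring_distribs power_add mult.assoc right_diff_distrib)
  finally show ?thesis
    unfolding A_def B_def C_def by (rule fps_nonneg_X_power_mult)
qed

text \<open>Inserting a part of size i <= c into a partition in the box is injective and raises the
  weight by i.\<close>

lemma G_mono_length: "fps_nonneg (G (Suc s) (Suc c) - q ^ i * G s (Suc c))" if "i \<le> c"
  using that
proof (induction s arbitrary: c)
  case 0
  have "fps_nonneg (G (Suc 0) (Suc c) - q ^ i)" if "i \<le> c" for c
    using that
  proof (induction c)
    case (Suc c)
    show ?case
    proof (cases "i = Suc c")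
      case False
      hence "fps_nonneg (G (Suc 0) (Suc c) - q ^ i)"
        using Suc by simp
      hence "fps_nonneg (G (Suc 0) (Suc c) - q ^ i + q ^ Suc c)"
        by (rule fps_nonneg_add[OF _ fps_nonneg_power[OF fps_nonneg_X]])
      then show ?thesis by (simp add: G.simps(3)[of 0 "Suc c"] algebra_simps)
    qed (simp add: G.simps(3)[of 0 "Suc c"])
  qed simp
  then show ?case using 0 by simp
next
  case (Suc s)
  show ?case using Suc.prems
  proof (induction c)
    case 0
    then show ?case by simp
  next
    case (Suc c)
    show ?case
    proof (cases "i = Suc c")
      case True
      then show ?thesis by (subst G.simps(3)) simp
    next
      case False
      hence "fps_nonneg (G (Suc (Suc s)) (Suc c) - q ^ i * G (Suc s) (Suc c))"
        using Suc by simp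
      moreover have "fps_nonneg (G (Suc s) (Suc (Suc c)) - q ^ i * G s (Suc (Suc c)))"
        using Suc.prems \<open>\<And>c. i \<le> c \<Longrightarrow> _\<close> by blast
      moreover have "G (Suc (Suc s)) (Suc (Suc c)) - q ^ i * G (Suc s) (Suc (Suc c))
        = (G (Suc (Suc s)) (Suc c) - q ^ i * G (Suc s) (Suc c))
          + q ^ Suc c * (G (Suc s) (Suc (Suc c)) - q ^ i * G s (Suc (Suc c)))"
        by (simp only: G.simps ring_distribs) (simp add: algebra_simps)
      ultimately show ?thesis by (simp only:) (intro fps_nonneg_add fps_nonneg_mult fps_nonneg_power fps_nonneg_X)
    qed
  qed
qed

lemma G_mono_length': "fps_nonneg (G (Suc s) c - G s c)" if "s > 0 \<or> c > 0"
proof (cases c)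
  case 0
  then show ?thesis using that by (cases s) auto
next
  case (Suc c')
  then show ?thesis using G_mono_length[of 0 c' s] by simp
qed

lemma Gz_eq: "x = int a \<Longrightarrow> y = int b \<Longrightarrow> Gz x y = G a (Suc b)"
  by simp

text \<open>Log-concavity with starting points that differ only in their height m gives the
  inequality with \<open>G (Suc s) (m + c)\<close> in the first product. One more row, possibly
  empty, only enlarges that factor.\<close>

lemma G_exchange:
  "fps_nonneg (G (Suc (Suc s)) (m + c) * G s (Suc c) - q ^ m * (G s (Suc (m + c)) * G (Suc s) c))"
proof (cases c)
  case 0
  then show ?thesis by (simp add: fps_nonneg_mult)
next
  case (Suc b)
  have "fps_nonneg (G s (Suc (Suc b)) * G (Suc s) (Suc (m + b))
      - q ^ m * (G (Suc s) (Suc b) * G s (Suc (Suc (m + b)))))"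
    using Gz_log_concave[of s "Suc b" 1 0 1 m]
    by (simp add: Gz_eq[of _ "Suc s" _ b] Gz_eq[of _ "Suc s" _ "m + b"] Gz_eq[of _ s _ "Suc (m + b)"])
  moreover have "fps_nonneg (G (Suc (Suc s)) (Suc (m + b)) * G s (Suc (Suc b))
      - G (Suc s) (Suc (m + b)) * G s (Suc (Suc b)))"
    by (intro fps_nonneg_mult_mono G_mono_length') simp_all
  ultimately show ?thesis
    using Suc by (auto simp: mult.commute intro: fps_nonneg_trans)
qed

text \<open>For m = l + 1 the factor \<open>q ^ m\<close> arises in two pieces: starting heights
  differing by 1 give q, and inserting a part of size l gives \<open>q ^ l\<close>. For m = 0,
  starting points at equal height suffice. The determinant is applied to the conjugate boxes, hence
  \<open>G_sym\<close>.\<close>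

lemma G_exchange':
  "fps_nonneg (G (Suc (Suc s)) (Suc (Suc m + c)) * G (Suc s) (Suc c)
    - q ^ m * (G s (Suc (Suc (Suc m + c))) * G (Suc (Suc s)) c))"
proof (cases c)
  case 0
  then show ?thesis by (simp add: fps_nonneg_mult)
next
  case b: (Suc b)
  show ?thesis
  proof (cases m)
    case 0
    have "fps_nonneg (G (Suc (Suc b)) (Suc (Suc (Suc s))) * G (Suc b) (Suc s)
        - G (Suc (Suc (Suc b))) (Suc s) * G b (Suc (Suc (Suc s))))"
      using Gz_log_concave[of "Suc (Suc b)" "Suc (Suc s)" 1 2 2 0]
      by (simp add: Gz_eq[of _ "Suc b" _ s] Gz_eq[of _ "Suc (Suc (Suc b))" _ s] Gz_eq[of _ b _ "Suc (Suc s)"])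
    hence "fps_nonneg (G (Suc (Suc s)) (Suc (Suc (Suc b))) * G s (Suc (Suc b))
        - G s (Suc (Suc (Suc (Suc b)))) * G (Suc (Suc s)) (Suc b))"
      by (simp only: G_sym[of "Suc (Suc b)"] G_sym[of "Suc b"] G_sym[of b] G_sym[of "Suc (Suc (Suc b))"])
    moreover have "fps_nonneg (G (Suc (Suc s)) (Suc (Suc (Suc b))) * G (Suc s) (Suc (Suc b))
        - G (Suc (Suc s)) (Suc (Suc (Suc b))) * G s (Suc (Suc b)))"
      by (intro fps_nonneg_mult_mono G_mono_length') simp_all
    ultimately show ?thesis
      using 0 b by (auto intro: fps_nonneg_trans)
  next
    case (Suc l)
    have "fps_nonneg (G (Suc (Suc (Suc (l + b)))) (Suc (Suc s)) * G (Suc b) (Suc (Suc s))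
        - q * (G (Suc (Suc (Suc (Suc (l + b))))) (Suc s) * G b (Suc (Suc (Suc s)))))"
      using Gz_log_concave[of "Suc (Suc (Suc (l + b)))" "Suc s" 1 "l + 3" 1 1]
      by (simp add: Gz_eq[of _ "Suc b" _ "Suc s"] Gz_eq[of _ "Suc (Suc (Suc (Suc (l + b))))" _ s]
          Gz_eq[of _ b _ "Suc (Suc s)"])
    hence 1: "fps_nonneg (G (Suc s) (Suc (Suc (Suc (Suc (l + b))))) * G (Suc s) (Suc (Suc b))
        - q * (G s (Suc (Suc (Suc (Suc (Suc (l + b)))))) * G (Suc (Suc s)) (Suc b)))"
      by (simp only: G_sym[of "Suc (Suc (Suc (l + b)))"] G_sym[of "Suc b"] G_sym[of b]
          G_sym[of "Suc (Suc (Suc (Suc (l + b))))"])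
    have "fps_nonneg (G (Suc (Suc s)) (Suc (Suc (Suc (Suc (l + b))))) * G (Suc s) (Suc (Suc b))
        - q ^ l * G (Suc s) (Suc (Suc (Suc (Suc (l + b))))) * G (Suc s) (Suc (Suc b)))"
      by (intro fps_nonneg_mult_mono G_mono_length) (simp_all add: fps_nonneg_mult)
    moreover have "fps_nonneg (q ^ l * (G (Suc s) (Suc (Suc (Suc (Suc (l + b))))) * G (Suc s) (Suc (Suc b))
        - q * (G s (Suc (Suc (Suc (Suc (Suc (l + b)))))) * G (Suc (Suc s)) (Suc b))))"
      by (intro fps_nonneg_mult[OF _ 1]) simp
    ultimately show ?thesis
      using Suc b by (auto simp: algebra_simps intro: fps_nonneg_trans)
  qed
qed

section \<open>Heine's transformation\<close>

definition qbinom :: "nat \<Rightarrow> nat \<Rightarrow> int fps" where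
  "qbinom n k = (if k \<le> n then G k (Suc (n - k)) else 0)"

lemma qbinom_0 [simp]: "qbinom n 0 = 1"
  by (simp add: qbinom_def)

lemma qbinom_eq_0 [simp]: "n < k \<Longrightarrow> qbinom n k = 0"
  by (simp add: qbinom_def)

lemma qbinom_eq_Gz: "qbinom n k = Gz (int k) (int n - int k)"
  by (auto simp: qbinom_def Gz_def nat_diff_distrib)

lemma qbinom_Suc: "qbinom (Suc n) (Suc k) = qbinom n k + q ^ Suc k * qbinom n (Suc k)"
proof (cases "k < n")
  case True
  then obtain t where "n = Suc (k + t)" using less_imp_Suc_add by blast
  then show ?thesis by (simp add: qbinom_def Suc_diff_le) (simp only: G_Suc' power_Suc)
qed (auto simp: qbinom_def)

lemma qbinom_Suc': "qbinom (Suc n) (Suc k) = q ^ (n - k) * qbinom n k + qbinom n (Suc k)"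
proof (cases "k < n")
  case True
  then obtain t where "n = Suc (k + t)" using less_imp_Suc_add by blast
  then show ?thesis by (simp add: qbinom_def Suc_diff_le G.simps(3))
qed (auto simp: qbinom_def)

lemma qbinom_ratio: "qbinom n k * (1 - q ^ (n - k)) = qbinom n (Suc k) * (1 - q ^ Suc k)"
  using qbinom_Suc[of n k] qbinom_Suc'[of n k] by (simp add: algebra_simps)

lemma one_minus_X_power_neq_0: "(1::int fps) - q ^ Suc k \<noteq> 0"
proof
  assume "(1::int fps) - q ^ Suc k = 0"
  hence "((1::int fps) - q ^ Suc k) $ 0 = 0" by simp
  thus False by simp
qed

lemma G_ratio: "G s (Suc (Suc c)) * (1 - q ^ Suc c) = G s (Suc c) * (1 - q ^ (s + Suc c))"
proof (cases s)
  case (Suc t)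
  have 1: "G s (Suc (Suc c)) = G s (Suc c) + q ^ Suc c * G t (Suc (Suc c))"
    and 2: "G s (Suc (Suc c)) = G t (Suc (Suc c)) + q ^ s * G s (Suc c)"
    unfolding Suc by (rule G.simps, rule G_Suc')
  have "G t (Suc (Suc c)) = G s (Suc (Suc c)) - q ^ s * G s (Suc c)" using 2 by simp
  hence "G s (Suc (Suc c)) = G s (Suc c) + q ^ Suc c * (G s (Suc (Suc c)) - q ^ s * G s (Suc c))"
    using 1 by simp
  then show ?thesis by (simp only: power_add) (simp add: algebra_simps)
qed simp

text \<open>In \<open>heine\<close> this is used with t = s - k and j = k + A: the common factor 1 -
  q^(s + A) turns into weights free of s, while the width grows by one.\<close>

lemma G_split:
  "(1 - q ^ (t + j)) * G t (Suc c)
    = (1 - q ^ j) * G t (Suc (Suc c)) + (q ^ j - q ^ Suc c) * (if t = 0 then 0 else G (t - 1) (Suc (Suc c)))"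
proof (cases t)
  case (Suc r)
  have 1: "G t (Suc (Suc c)) = G t (Suc c) + q ^ Suc c * G r (Suc (Suc c))"
    and 2: "G t (Suc (Suc c)) = G r (Suc (Suc c)) + q ^ t * G t (Suc c)"
    unfolding Suc by (rule G.simps, rule G_Suc')
  have "(1 - q ^ j) * G t (Suc (Suc c)) + (q ^ j - q ^ Suc c) * G r (Suc (Suc c))
      = (G t (Suc (Suc c)) - q ^ Suc c * G r (Suc (Suc c))) - q ^ j * (G t (Suc (Suc c)) - G r (Suc (Suc c)))"
    by (simp add: algebra_simps)
  also have "G t (Suc (Suc c)) - q ^ Suc c * G r (Suc (Suc c)) = G t (Suc c)"
    unfolding 1 by simp
  also have "G t (Suc (Suc c)) - G r (Suc (Suc c)) = q ^ t * G t (Suc c)"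
    unfolding 2 by simp
  finally show ?thesis using Suc by (simp only: power_add) (simp add: algebra_simps)
qed simp

text \<open>Both sides are the q-multinomial coefficient of s + d + b with lower entries s, d, b. It
  is the case a = 0 of \<open>heine\<close>, where only k = 0 survives.\<close>

lemma G_trinomial: "G s (Suc d) * G (s + d) (Suc b) = G d (Suc b) * G s (Suc (d + b))"
proof (induction b)
  case (Suc b)
  have "G s (Suc d) * G (s + d) (Suc (Suc b)) * (1 - q ^ Suc b)
      = G s (Suc d) * (G (s + d) (Suc b) * (1 - q ^ (s + d + Suc b)))"
    by (simp only: mult.assoc G_ratio)
  also have "\<dots> = (G s (Suc d) * G (s + d) (Suc b)) * (1 - q ^ (s + d + Suc b))"
    by (simp only: mult.assoc)
  also have "\<dots> = G d (Suc b) * (G s (Suc (d + b)) * (1 - q ^ (s + Suc (d + b))))"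
    unfolding Suc.IH by (simp add: mult.assoc add.assoc)
  also have "G s (Suc (d + b)) * (1 - q ^ (s + Suc (d + b))) = G s (Suc (Suc (d + b))) * (1 - q ^ Suc (d + b))"
    by (rule G_ratio[symmetric])
  also have "G d (Suc b) * (G s (Suc (Suc (d + b))) * (1 - q ^ Suc (d + b)))
      = (G d (Suc b) * (1 - q ^ (d + Suc b))) * G s (Suc (Suc (d + b)))"
    by (simp add: mult_ac)
  also have "\<dots> = G d (Suc (Suc b)) * G s (Suc (d + Suc b)) * (1 - q ^ Suc b)"
    unfolding G_ratio[symmetric] by (simp only: mult_ac add_Suc_right)
  finally show ?case
    using one_minus_X_power_neq_0 mult_right_cancel by blast
qed simp

text \<open>The coefficient form of Heine's transformation of a \<open>2\<phi>1\<close> series into a terminating one.\<close>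
lemma heine:
  "G s (Suc (a + d)) * G (s + d) (Suc b)
    = (\<Sum>k\<le>s. q ^ (k * (k + d)) * qbinom a k * qbinom (b + d) (k + d) * G (s - k) (Suc (a + d + b)))"
proof (induction a)
  case 0
  have "(\<Sum>k\<le>s. q ^ (k * (k + d)) * qbinom 0 k * qbinom (b + d) (k + d) * G (s - k) (Suc (0 + d + b)))
      = (\<Sum>k\<in>{0}. q ^ (k * (k + d)) * qbinom 0 k * qbinom (b + d) (k + d) * G (s - k) (Suc (0 + d + b)))"
    by (rule sum.mono_neutral_right) auto
  then show ?case by (simp add: G_trinomial) (simp add: qbinom_def)
next
  case (Suc a)
  define A N where "A = Suc (a + d)" and "N = a + d + b"
  define w where "w a k = q ^ (k * (k + d)) * qbinom a k * qbinom (b + d) (k + d)" for a k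
  define H where "H t = G t (Suc (Suc N))" for t
  \<comment> \<open>The induction step is multiplied by 1 - q^A. Since \<open>G_split\<close>
    spreads term k over \<open>H (s - k)\<close> and \<open>H (s - k - 1)\<close>, this is the
    comparison of coefficients at \<open>H (s - k)\<close>. Both Pascal rules for
    \<open>qbinom (Suc a) k\<close> enter.\<close>
  have w_rec: "w a k * (1 - q ^ (k + A)) + (if k = 0 then 0 else w a (k - 1) * (q ^ (k - 1 + A) - q ^ Suc N))
      = w (Suc a) k * (1 - q ^ A)" for k
  proof (cases k)
    case 0
    then show ?thesis by (simp add: w_def)
  next
    case k: (Suc l)
    define E where "E = q ^ (k * (k + d))"
    define b0 b1 where "b0 = qbinom (b + d) (l + d)" and "b1 = qbinom (b + d) (k + d)"
    have "b0 * (q ^ (l + A) - q ^ Suc N) = q ^ (l + A) * (b1 * (1 - q ^ (k + d)))"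
    proof (cases "l \<le> b")
      case True
      have e: "Suc N = l + A + (b + d - (l + d))" using True by (simp add: N_def A_def)
      have "b0 * (q ^ (l + A) - q ^ Suc N) = q ^ (l + A) * (b0 * (1 - q ^ (b + d - (l + d))))"
        unfolding e power_add by (simp add: algebra_simps)
      also have "b0 * (1 - q ^ (b + d - (l + d))) = b1 * (1 - q ^ (k + d))"
        unfolding b0_def b1_def k using qbinom_ratio[of "b + d" "l + d"] by simp
      finally show ?thesis .
    qed (simp add: b0_def b1_def k)
    moreover have "q ^ (l * (l + d)) * q ^ (l + A) * qbinom a l = E * (q ^ (a - l) * qbinom a l)"
    proof (cases "l \<le> a")
      case True
      have "l * (l + d) + (l + A) = k * (k + d) + (a - l)"
        using True by (simp add: k A_def algebra_simps)
      then show ?thesis by (simp add: E_def power_add[symmetric] mult.assoc[symmetric])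
    qed simp
    ultimately have 1: "w a (k - 1) * (q ^ (k - 1 + A) - q ^ Suc N)
        = E * (q ^ (a - l) * qbinom a l) * (b1 * (1 - q ^ (k + d)))"
      by (simp add: w_def k b0_def) (metis (no_types, lifting) mult.assoc mult.left_commute)
    have 2: "q ^ (a - l) * qbinom a l * q ^ (k + d) = q ^ A * qbinom a l"
    proof (cases "l \<le> a")
      case True
      have "a - l + (k + d) = A" using True by (simp add: k A_def)
      then show ?thesis by (metis (no_types, lifting) mult.assoc mult.commute power_add)
    qed simp
    have 3: "qbinom (Suc a) k = q ^ (a - l) * qbinom a l + qbinom a k"
      unfolding k by (rule qbinom_Suc')
    have 4: "qbinom (Suc a) k = qbinom a l + q ^ k * qbinom a k"
      unfolding k by (rule qbinom_Suc)
    have "w a (k - 1) * (q ^ (k - 1 + A) - q ^ Suc N)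
        = E * b1 * (q ^ (a - l) * qbinom a l - q ^ (a - l) * qbinom a l * q ^ (k + d))"
      unfolding 1 by (simp add: algebra_simps)
    also have "\<dots> = E * b1 * (q ^ (a - l) * qbinom a l - q ^ A * qbinom a l)"
      by (simp only: 2)
    finally have *: "w a (k - 1) * (q ^ (k - 1 + A) - q ^ Suc N)
        = E * b1 * (q ^ (a - l) * qbinom a l - q ^ A * qbinom a l)" .
    have **: "qbinom a l = qbinom (Suc a) k - q ^ k * qbinom a k"
        "q ^ (a - l) * qbinom a l = qbinom (Suc a) k - qbinom a k"
      using 3 4 by (simp_all add: algebra_simps)
    have "w a k * (1 - q ^ (k + A)) + w a (k - 1) * (q ^ (k - 1 + A) - q ^ Suc N)
        = E * b1 * (qbinom a k * (1 - q ^ (k + A))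
          + (qbinom (Suc a) k - qbinom a k - q ^ A * (qbinom (Suc a) k - q ^ k * qbinom a k)))"
      unfolding * unfolding **(2) unfolding **(1)
      by (simp add: w_def E_def b1_def algebra_simps)
    also have "\<dots> = w (Suc a) k * (1 - q ^ A)"
      by (simp add: w_def E_def b1_def power_add algebra_simps)
    finally show ?thesis by (simp add: k)
  qed
  have shift: "(\<Sum>k\<le>s. w a k * (q ^ (k + A) - q ^ Suc N) * (if s - k = 0 then 0 else H (s - k - 1)))
      = (\<Sum>k\<le>s. (if k = 0 then 0 else w a (k - 1) * (q ^ (k - 1 + A) - q ^ Suc N)) * H (s - k))"
  proof (cases s)
    case (Suc t)
    have "(\<Sum>k\<le>Suc t. w a k * (q ^ (k + A) - q ^ Suc N) * (if Suc t - k = 0 then 0 else H (Suc t - k - 1)))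
        = (\<Sum>k\<le>t. w a k * (q ^ (k + A) - q ^ Suc N) * H (t - k))"
      by (simp add: Suc_diff_le)
    also have "\<dots> = (\<Sum>k\<le>Suc t. (if k = 0 then 0 else w a (k - 1) * (q ^ (k - 1 + A) - q ^ Suc N)) * H (Suc t - k))"
      by (subst sum.atMost_Suc_shift) simp
    finally show ?thesis unfolding Suc .
  qed simp
  have "G s (Suc (Suc a + d)) * G (s + d) (Suc b) * (1 - q ^ A)
      = (G s (Suc A) * (1 - q ^ A)) * G (s + d) (Suc b)"
    by (simp add: A_def mult_ac)
  also have "\<dots> = (1 - q ^ (s + A)) * (G s (Suc (a + d)) * G (s + d) (Suc b))"
    unfolding A_def G_ratio by (simp add: mult_ac)
  also have "\<dots> = (\<Sum>k\<le>s. w a k * ((1 - q ^ (s + A)) * G (s - k) (Suc N)))"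
    unfolding Suc.IH by (simp add: sum_distrib_left w_def N_def mult_ac)
  also have "\<dots> = (\<Sum>k\<le>s. w a k * ((1 - q ^ (k + A)) * H (s - k)
      + (q ^ (k + A) - q ^ Suc N) * (if s - k = 0 then 0 else H (s - k - 1))))"
  proof (rule sum.cong[OF refl])
    fix k assume "k \<in> {..s}"
    hence "s + A = s - k + (k + A)" by simp
    thus "w a k * ((1 - q ^ (s + A)) * G (s - k) (Suc N)) = w a k * ((1 - q ^ (k + A)) * H (s - k)
      + (q ^ (k + A) - q ^ Suc N) * (if s - k = 0 then 0 else H (s - k - 1)))"
      unfolding H_def by (simp only: G_split)
  qed
  also have "\<dots> = (\<Sum>k\<le>s. w a k * (1 - q ^ (k + A)) * H (s - k))
      + (\<Sum>k\<le>s. w a k * (q ^ (k + A) - q ^ Suc N) * (if s - k = 0 then 0 else H (s - k - 1)))"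
    by (simp only: distrib_left mult.assoc sum.distrib)
  also have "\<dots> = (\<Sum>k\<le>s. w (Suc a) k * (1 - q ^ A) * H (s - k))"
    unfolding shift w_rec[symmetric] by (simp only: distrib_right sum.distrib)
  also have "\<dots> = (\<Sum>k\<le>s. w (Suc a) k * H (s - k)) * (1 - q ^ A)"
    by (simp add: sum_distrib_left mult_ac)
  finally have "G s (Suc (Suc a + d)) * G (s + d) (Suc b) = (\<Sum>k\<le>s. w (Suc a) k * H (s - k))"
    unfolding A_def using one_minus_X_power_neq_0 mult_right_cancel by blast
  then show ?case by (simp add: w_def H_def N_def)
qed

text \<open>The series \<open>1 / ((1 - q ^ 2) \<dots> (1 - q ^ (c + 2)))\<close>.\<close>
definition parts_ge_2 :: "nat \<Rightarrow> int fps" where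
  "parts_ge_2 c = fsum (\<lambda>s. q ^ (2 * s) * G s (Suc c))"

lemma fps_small_parts: "fps_small (\<lambda>s. q ^ (2 * s) * G s (Suc c))"
  by (rule fps_smallI) auto

lemma fps_nonneg_parts_ge_2: "fps_nonneg (parts_ge_2 c)"
  unfolding parts_ge_2_def by (intro fps_nonneg_fsum fps_nonneg_mult) simp_all

text \<open>A partition with parts from 2 to c + 3 either avoids the part c + 3 or arises by adding
  one such part.\<close>

lemma parts_ge_2_Suc: "parts_ge_2 (Suc c) = parts_ge_2 c + q ^ (c + 3) * parts_ge_2 (Suc c)"
proof -
  have "parts_ge_2 (Suc c) = 1 + fsum (\<lambda>s. q ^ (2 * Suc s) * G (Suc s) (Suc (Suc c)))"
    unfolding parts_ge_2_def by (subst fsum_Suc[OF fps_small_parts]) simp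
  also have "(\<lambda>s. q ^ (2 * Suc s) * G (Suc s) (Suc (Suc c)))
      = (\<lambda>s. q ^ (2 * Suc s) * G (Suc s) (Suc c) + q ^ (c + 3) * (q ^ (2 * s) * G s (Suc (Suc c))))"
    by (rule ext) (simp add: G.simps(3) algebra_simps power_add power2_eq_square eval_nat_numeral)
  also have "1 + fsum \<dots> = (1 + fsum (\<lambda>s. q ^ (2 * Suc s) * G (Suc s) (Suc c))) + q ^ (c + 3) * parts_ge_2 (Suc c)"
    unfolding fsum_add fsum_cmult[OF fps_small_parts] parts_ge_2_def by (simp only: add.assoc)
  also have "1 + fsum (\<lambda>s. q ^ (2 * Suc s) * G (Suc s) (Suc c)) = parts_ge_2 c"
    unfolding parts_ge_2_def by (subst fsum_Suc[OF fps_small_parts]) simp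
  finally show ?thesis .
qed

text \<open>This is f = h / (1 - q^(k + 1)) without division: each coefficient of f is one of h
  plus, possibly, an earlier one of f.\<close>

lemma fps_nonneg_geometric:
  assumes "f = h + q ^ Suc k * f" "fps_nonneg h"
  shows "fps_nonneg f"
  unfolding fps_nonneg_def
proof
  fix n show "0 \<le> f $ n"
  proof (induction n rule: less_induct)
    case (less n)
    have "f $ n = (h + q ^ Suc k * f) $ n" using assms(1) by simp
    also have "\<dots> = h $ n + (if n < Suc k then 0 else f $ (n - Suc k))"
      by (simp only: fps_add_nth fps_X_power_mult_nth)
    finally show ?case using assms(2) less by (auto simp: fps_nonneg_def)
  qed
qed

text \<open>One of the factors of the denominator of \<^term>\<open>parts_ge_2 (Suc c)\<close> is \<open>1 - q ^ 3\<close>.\<close>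
lemma fps_nonneg_parts_ge_2_Suc: "fps_nonneg ((1 - q ^ 3) * parts_ge_2 (Suc c))"
proof (induction c)
  case 0
  have "parts_ge_2 1 = parts_ge_2 0 + q ^ 3 * parts_ge_2 1"
    using parts_ge_2_Suc[of 0] by (simp add: numeral_3_eq_3)
  hence "(1 - q ^ 3) * parts_ge_2 1 = parts_ge_2 0"
    by (metis add_diff_cancel_right' left_diff_distrib mult_1)
  then show ?case
    using fps_nonneg_parts_ge_2[of 0] by simp
next
  case (Suc c)
  have "(1 - q ^ 3) * parts_ge_2 (Suc (Suc c))
      = (1 - q ^ 3) * (parts_ge_2 (Suc c) + q ^ (Suc c + 3) * parts_ge_2 (Suc (Suc c)))"
    by (rule arg_cong[OF parts_ge_2_Suc])
  also have "\<dots> = (1 - q ^ 3) * parts_ge_2 (Suc c)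
      + q ^ Suc (c + 3) * ((1 - q ^ 3) * parts_ge_2 (Suc (Suc c)))"
    by (simp add: algebra_simps)
  finally show ?case using Suc.IH by (rule fps_nonneg_geometric)
qed

definition heine_num :: "nat \<Rightarrow> nat \<Rightarrow> int fps" where
  "heine_num n k = q ^ (k * k + 3 * k) * (qbinom n k * qbinom (Suc n) k)
    - q ^ (k * k + 5 * k + 3) * (qbinom n k * qbinom (Suc n) (k + 2))"

lemma fps_small_heine_num: "fps_small (heine_num n)"
  unfolding heine_num_def by (intro fps_small_diff; rule fps_smallI) auto

text \<open>\<open>heine\<close> is applied with (a, d, b) = (n, 1, n + 1) and (n, 2, n). Both
  choices have a + d + b = 2n + 2, so the two expansions share their last factor and the sum over s
  becomes a Cauchy product.\<close>

lemma heine_difference: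
  "fsum (\<lambda>s. q ^ (2 * s) * (G (Suc s) (n + 2) * G s (n + 2) - q * (G s (n + 3) * G (s + 2) (n + 1))))
    = fsum (heine_num n) * parts_ge_2 (2 * n + 2)"
proof -
  have num: "q ^ (2 * k) * (q ^ (k * (k + 1)) * qbinom n k * qbinom (n + 2) (k + 1)
      - q * (q ^ (k * (k + 2)) * qbinom n k * qbinom (n + 2) (k + 2))) = heine_num n k" for k
  proof -
    \<comment> \<open>After these expansions the two terms with
      \<open>qbinom (Suc n) (Suc k)\<close> carry the same power of q and cancel.\<close>
    have 1: "qbinom (n + 2) (k + 1) = qbinom (Suc n) k + q ^ Suc k * qbinom (Suc n) (Suc k)"
      and 2: "qbinom (n + 2) (k + 2) = qbinom (Suc n) (Suc k) + q ^ Suc (Suc k) * qbinom (Suc n) (k + 2)"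
      using qbinom_Suc[of "Suc n"] by simp_all
    show ?thesis unfolding 1 2 heine_num_def
      by (simp add: algebra_simps qpow power2_eq_square eval_nat_numeral)
  qed
  have "q ^ (2 * s) * (G (Suc s) (n + 2) * G s (n + 2) - q * (G s (n + 3) * G (s + 2) (n + 1)))
      = (\<Sum>k\<le>s. heine_num n k * (q ^ (2 * (s - k)) * G (s - k) (Suc (2 * n + 2))))" for s
  proof -
    have 1: "G (Suc s) (n + 2) * G s (n + 2) = (\<Sum>k\<le>s. q ^ (k * (k + 1)) * qbinom n k * qbinom (n + 2) (k + 1)
        * G (s - k) (Suc (2 * n + 2)))"
      using heine[of s n 1 "n + 1"] by (simp add: mult.commute mult_2_right)
    have 2: "G s (n + 3) * G (s + 2) (n + 1) = (\<Sum>k\<le>s. q ^ (k * (k + 2)) * qbinom n k * qbinom (n + 2) (k + 2)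
        * G (s - k) (Suc (2 * n + 2)))"
      using heine[of s n 2 n] by (simp add: mult_2 add.commute eval_nat_numeral)
    have "q ^ (2 * s) * (G (Suc s) (n + 2) * G s (n + 2) - q * (G s (n + 3) * G (s + 2) (n + 1)))
        = (\<Sum>k\<le>s. q ^ (2 * s) * (q ^ (k * (k + 1)) * qbinom n k * qbinom (n + 2) (k + 1)
      - q * (q ^ (k * (k + 2)) * qbinom n k * qbinom (n + 2) (k + 2))) * G (s - k) (Suc (2 * n + 2)))"
      unfolding 1 2 by (simp add: sum_distrib_left sum_subtractf left_diff_distrib right_diff_distrib mult.assoc)
    also have "\<dots> = (\<Sum>k\<le>s. heine_num n k * (q ^ (2 * (s - k)) * G (s - k) (Suc (2 * n + 2))))"
    proof (rule sum.cong[OF refl])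
      fix k assume "k \<in> {..s}"
      hence "2 * s = 2 * k + 2 * (s - k)" by simp
      hence "q ^ (2 * s) = q ^ (2 * k) * q ^ (2 * (s - k))" by (metis power_add)
      thus "q ^ (2 * s) * (q ^ (k * (k + 1)) * qbinom n k * qbinom (n + 2) (k + 1)
          - q * (q ^ (k * (k + 2)) * qbinom n k * qbinom (n + 2) (k + 2))) * G (s - k) (Suc (2 * n + 2))
        = heine_num n k * (q ^ (2 * (s - k)) * G (s - k) (Suc (2 * n + 2)))"
        unfolding num[symmetric] by (simp only: mult_ac)
    qed
    finally show ?thesis .
  qed
  thus ?thesis
    unfolding parts_ge_2_def fsum_mult[OF fps_small_heine_num fps_small_parts] by simp
qed

text \<open>The \<open>Gz\<close> factor is \<open>qbinom r (k - 1)\<close> for k > 0 and 0 for k =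
  0, where truncated subtraction would give \<open>qbinom r 0\<close>.\<close>

lemma qbinom_log_concave:
  "fps_nonneg (qbinom r k * qbinom r k - q * (Gz (int k - 1) (int r - int k + 1) * qbinom r (Suc k)))"
proof (cases "k \<le> r")
  case True
  have "G k (Suc (r - k)) = qbinom r k"
    "Gz (int k + int 1 - int 1) (int (r - k) - int 1 + int 1) = qbinom r k"
    "Gz (int k + int 1) (int (r - k) - int 1) = qbinom r (Suc k)"
    "Gz (int k - int 1) (int (r - k) + int 1) = Gz (int k - 1) (int r - int k + 1)"
    using True by (simp_all add: qbinom_eq_Gz of_nat_diff algebra_simps flip: Gz_nat)
  then show ?thesis
    using Gz_log_concave[of k "r - k" 1 1 1 1] by (simp add: mult.commute)
qed (simp add: fps_nonneg_mult)

lemma qbinom_log_concave':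
  "fps_nonneg (qbinom r k * qbinom r (Suc k)
    - q ^ 2 * (Gz (int k - 1) (int r - int k + 1) * qbinom r (Suc (Suc k))))"
proof (cases "k \<le> r")
  case True
  have "G k (Suc (r - k)) = qbinom r k"
    "Gz (int k + int 2 - int 1) (int (r - k) - int 2 + int 1) = qbinom r (Suc k)"
    "Gz (int k + int 2) (int (r - k) - int 2) = qbinom r (Suc (Suc k))"
    "Gz (int k - int 1) (int (r - k) + int 1) = Gz (int k - 1) (int r - int k + 1)"
    using True by (simp_all add: qbinom_eq_Gz of_nat_diff algebra_simps flip: Gz_nat)
  then show ?thesis
    using Gz_log_concave[of k "r - k" 2 1 2 1] by (simp add: mult.commute)
qed (simp add: fps_nonneg_mult)

text \<open>Expanding all coefficients down to row \<open>r\<close>, the products \<open>[r, i] [r, j]\<close> with \<open>|i - j| = 1\<close> and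
  \<open>|i - j| = 2\<close> recombine, up to shifts of \<open>k\<close>, with the squares into log-concavity differences.\<close>
lemma heine_num_decomposition:
  fixes r
  defines "D \<equiv> \<lambda>k. q ^ (k * k + 5 * k) * (qbinom r k * qbinom r k
      - q * (Gz (int k - 1) (int r - int k + 1) * qbinom r (Suc k)))"
    and "E \<equiv> \<lambda>k. q ^ (k * k + 6 * k + r + 6) * (qbinom r k * qbinom r (Suc k)
      - q ^ 2 * (Gz (int k - 1) (int r - int k + 1) * qbinom r (Suc (Suc k))))"
  shows "fsum (heine_num (Suc r))
    = (1 - q ^ 3) * fsum D + fsum (\<lambda>k. (1 + q) * q ^ (r + 4) * D k + E k)"
proof -
  define R where "R k = qbinom r k" for k
  \<comment> \<open>R1 and R2 are \<open>qbinom r\<close> at k - 1 and k - 2, with value 0 at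
    negative indices.\<close>
  define R1 where "R1 k = (case k of 0 \<Rightarrow> 0 | Suc j \<Rightarrow> R j)" for k
  define R2 where "R2 k = (case k of 0 \<Rightarrow> 0 | Suc j \<Rightarrow> R1 j)" for k
  have R1_simps: "R1 0 = 0" "R1 (Suc k) = R k" for k by (simp_all add: R1_def)
  have R2_simps: "R2 0 = 0" "R2 (Suc k) = R1 k" for k by (simp_all add: R2_def)
  have Gz: "Gz (int k - 1) (int r - int k + 1) = R1 k" for k
    by (cases k) (simp_all add: R1_simps R_def qbinom_eq_Gz, simp add: Gz_def)
  \<comment> \<open>The factor \<open>q ^ k\<close> here, and q in \<open>n1\<close>, clears the
    exponents r + 1 - k and k - 1, which are not natural numbers for all k.\<close>
  have n: "q ^ k * qbinom (Suc r) k = q ^ k * R k + q ^ Suc r * R1 k" for k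
  proof (cases k)
    case (Suc j)
    have "q ^ Suc j * (q ^ (r - j) * R j) = q ^ Suc r * R j"
    proof (cases "j \<le> r")
      case True
      hence "Suc j + (r - j) = Suc r" by simp
      then show ?thesis by (metis mult.assoc power_add)
    qed (simp add: R_def)
    then show ?thesis
      unfolding Suc qbinom_Suc' R1_simps R_def[symmetric] by (simp only: ring_distribs) simp
  qed (simp add: R1_simps R_def)
  have n1: "q * qbinom (Suc (Suc r)) k = q * R2 k + (1 + q) * q ^ k * R1 k + q ^ (2 * k + 1) * R k" for k
  proof (cases k)
    case (Suc j)
    show ?thesis
    proof (cases j)
      case 0
      then show ?thesis
        by (simp add: Suc qbinom_Suc R1_simps R2_simps R_def algebra_simps power2_eq_square eval_nat_numeral)
    next
      case j: (Suc i)
      show ?thesis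
        by (simp add: Suc j qbinom_Suc R1_simps R2_simps R_def[symmetric] algebra_simps qpow eval_nat_numeral)
    qed
  qed (simp add: R1_simps R2_simps R_def)
  have n2: "qbinom (Suc (Suc r)) (k + 2)
      = R k + (1 + q) * q ^ Suc k * R (Suc k) + q ^ (2 * k + 4) * R (Suc (Suc k))" for k
    by (simp add: qbinom_Suc R_def[symmetric] algebra_simps qpow eval_nat_numeral)
  define f1 f2 f3 f4 f5 f6 where
    "f1 k = q ^ (k * k + 3 * k + 1) * (R k * R2 k)"
    and "f2 k = q ^ (k * k + 4 * k) * ((1 + q) * R k * R1 k)"
    and "f3 k = q ^ (k * k + 5 * k + 1) * (R k * R k)"
    and "f4 k = q ^ (k * k + 2 * k + r + 2) * (R1 k * R2 k)"
    and "f5 k = q ^ (k * k + 3 * k + r + 1) * ((1 + q) * R1 k * R1 k)"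
    and "f6 k = q ^ (k * k + 4 * k + r + 2) * (R1 k * R k)" for k
  define g1 g2 g3 g4 g5 g6 where
    "g1 k = q ^ (k * k + 5 * k + 4) * (R k * R k)"
    and "g2 k = q ^ (k * k + 6 * k + 5) * ((1 + q) * R k * R (Suc k))"
    and "g3 k = q ^ (k * k + 7 * k + 8) * (R k * R (Suc (Suc k)))"
    and "g4 k = q ^ (k * k + 4 * k + r + 5) * (R1 k * R k)"
    and "g5 k = q ^ (k * k + 5 * k + r + 6) * ((1 + q) * R1 k * R (Suc k))"
    and "g6 k = q ^ (k * k + 6 * k + r + 9) * (R1 k * R (Suc (Suc k)))" for k
  \<comment> \<open>The reflected partner of g3: \<open>h (Suc k) = g3 k\<close> and
    \<open>h 0 = 0\<close>. Its indices k - 1 and k + 1 are centred at k, as in D.\<close>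
  define h where "h k = q ^ (k * k + 5 * k + 2) * (R1 k * R (Suc k))" for k
  note f_defs = f1_def f2_def f3_def f4_def f5_def f6_def
  note g_defs = g1_def g2_def g3_def g4_def g5_def g6_def
  have small: "fps_small f1" "fps_small f2" "fps_small f4" "fps_small f5" "fps_small f6" "fps_small h"
    unfolding f_defs h_def by (rule fps_smallI, rule refl, simp)+
  \<comment> \<open>A shift by one cancels f2 against g2 and f4 against g4; the remaining shifts
    line the products up with those in D and E.\<close>
  have shift: "fsum f1 = fsum (\<lambda>k. f1 (Suc k))" "fsum f2 = fsum g2" "fsum f4 = fsum g4"
    "fsum f5 = fsum (\<lambda>k. f5 (Suc k))" "fsum f6 = fsum (\<lambda>k. f6 (Suc k))" "fsum h = fsum g3"
  proof -
    have "(\<lambda>k. f2 (Suc k)) = g2" "(\<lambda>k. f4 (Suc k)) = g4" "(\<lambda>k. h (Suc k)) = g3"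
      by (rule ext, simp add: f_defs g_defs h_def R1_simps R2_simps algebra_simps qpow eval_nat_numeral)+
    then show "fsum f1 = fsum (\<lambda>k. f1 (Suc k))" "fsum f2 = fsum g2" "fsum f4 = fsum g4"
      "fsum f5 = fsum (\<lambda>k. f5 (Suc k))" "fsum f6 = fsum (\<lambda>k. f6 (Suc k))" "fsum h = fsum g3"
      by (simp_all add: small[THEN fsum_Suc] f_defs h_def R1_simps R2_simps)
  qed
  have num: "q * heine_num (Suc r) k
      = (f1 k + f2 k + f3 k + f4 k + f5 k + f6 k) - (g1 k + g2 k + g3 k + g4 k + g5 k + g6 k)" for k
  proof -
    have "q * heine_num (Suc r) k
        = q ^ (k * k + 2 * k) * (q ^ k * qbinom (Suc r) k) * (q * qbinom (Suc (Suc r)) k)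
          - q ^ (k * k + 4 * k + 4) * (q ^ k * qbinom (Suc r) k) * qbinom (Suc (Suc r)) (k + 2)"
      by (simp add: heine_num_def algebra_simps qpow eval_nat_numeral)
    also have "\<dots> = (f1 k + f2 k + f3 k + f4 k + f5 k + f6 k) - (g1 k + g2 k + g3 k + g4 k + g5 k + g6 k)"
      unfolding n n1 n2 f_defs g_defs by (simp add: algebra_simps qpow eval_nat_numeral)
    finally show ?thesis .
  qed
  have D: "D k = q ^ (k * k + 5 * k) * (R k * R k - q * (R1 k * R (Suc k)))" for k
    by (simp add: D_def Gz R_def)
  have E: "E k = q ^ (k * k + 6 * k + r + 6) * (R k * R (Suc k) - q ^ 2 * (R1 k * R (Suc (Suc k))))" for k
    by (simp add: E_def Gz R_def)
  have small_D: "fps_small D"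
    unfolding D by (rule fps_smallI, rule refl, simp)
  \<comment> \<open>f1, f3, g1 and h form (1 - q^3) D, f5 and g5 form the multiple of D by (1 + q)
    q^(r + 4), and f6 and g6 form E, all up to the common factor q.\<close>
  have final: "f1 (Suc k) + f3 k + f5 (Suc k) + f6 (Suc k) - g1 k - h k - g5 k - g6 k
      = q * ((1 - q ^ 3) * D k + ((1 + q) * q ^ (r + 4) * D k + E k))" for k
    by (simp add: f_defs g_defs h_def D E R1_simps R2_simps algebra_simps qpow eval_nat_numeral)
  have "q * fsum (heine_num (Suc r)) = fsum (\<lambda>k. q * heine_num (Suc r) k)"
    by (rule fsum_cmult[OF fps_small_heine_num, symmetric])
  also have "\<dots> = (fsum f1 + fsum f2 + fsum f3 + fsum f4 + fsum f5 + fsum f6)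
      - (fsum g1 + fsum g2 + fsum g3 + fsum g4 + fsum g5 + fsum g6)"
    unfolding num by (simp only: fsum_add fsum_diff)
  also have "\<dots> = fsum (\<lambda>k. f1 (Suc k)) + fsum f3 + fsum (\<lambda>k. f5 (Suc k)) + fsum (\<lambda>k. f6 (Suc k))
      - fsum g1 - fsum h - fsum g5 - fsum g6"
    unfolding shift by simp
  also have "\<dots> = fsum (\<lambda>k. f1 (Suc k) + f3 k + f5 (Suc k) + f6 (Suc k) - g1 k - h k - g5 k - g6 k)"
    by (simp only: fsum_add fsum_diff)
  also have "\<dots> = fsum (\<lambda>k. q * ((1 - q ^ 3) * D k + ((1 + q) * q ^ (r + 4) * D k + E k)))"
    by (simp only: final)
  also have "\<dots> = q * fsum (\<lambda>k. (1 - q ^ 3) * D k + ((1 + q) * q ^ (r + 4) * D k + E k))"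
  proof (rule fsum_cmult)
    have "fps_small (\<lambda>k. D k * ((1 - q ^ 3) + (1 + q) * q ^ (r + 4)))"
      by (rule fps_small_mult[OF small_D])
    moreover have "fps_small E"
      unfolding E by (rule fps_smallI, rule refl, simp)
    ultimately have "fps_small (\<lambda>k. D k * ((1 - q ^ 3) + (1 + q) * q ^ (r + 4)) + E k)"
      by (rule fps_small_add)
    thus "fps_small (\<lambda>k. (1 - q ^ 3) * D k + ((1 + q) * q ^ (r + 4) * D k + E k))"
      by (simp add: algebra_simps)
  qed
  finally have "fsum (heine_num (Suc r)) = fsum (\<lambda>k. (1 - q ^ 3) * D k + ((1 + q) * q ^ (r + 4) * D k + E k))"
    by simp
  thus ?thesis
    by (simp only: fsum_add[of "\<lambda>k. (1 - q ^ 3) * D k"] fsum_cmult[OF small_D])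
qed

lemma heine_difference_nonneg:
  "fps_nonneg (fsum (\<lambda>s. q ^ (2 * s) * (G (Suc s) (n + 2) * G s (n + 2) - q * (G s (n + 3) * G (s + 2) (n + 1)))))"
proof (cases n)
  \<comment> \<open>The decomposition expands down to row n - 1, so n = 0 is separate; there the
    numerator is 1.\<close>
  case 0
  have "heine_num 0 k = (if k = 0 then 1 else 0)" for k
    by (cases k) (simp_all add: heine_num_def)
  moreover have "fsum (\<lambda>i. 0) = 0"
    by (rule fps_ext) (simp add: fsum_nth)
  ultimately have "fsum (heine_num 0) = 1"
    by (subst fsum_Suc[OF fps_small_heine_num]) simp
  then show ?thesis
    unfolding heine_difference 0 by (simp add: fps_nonneg_parts_ge_2)
next
  case (Suc r)
  define D where "D k = q ^ (k * k + 5 * k) * (qbinom r k * qbinom r k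
      - q * (Gz (int k - 1) (int r - int k + 1) * qbinom r (Suc k)))" for k
  define E where "E k = q ^ (k * k + 6 * k + r + 6) * (qbinom r k * qbinom r (Suc k)
      - q ^ 2 * (Gz (int k - 1) (int r - int k + 1) * qbinom r (Suc (Suc k))))" for k
  have D: "fps_nonneg (D k)" and E: "fps_nonneg (E k)" for k
    unfolding D_def E_def
    by (intro fps_nonneg_mult qbinom_log_concave qbinom_log_concave'; simp)+
  have "fsum (heine_num n) * parts_ge_2 (2 * n + 2)
      = fsum D * ((1 - q ^ 3) * parts_ge_2 (2 * n + 2))
        + fsum (\<lambda>k. (1 + q) * q ^ (r + 4) * D k + E k) * parts_ge_2 (2 * n + 2)"
    unfolding Suc heine_num_decomposition D_def E_def by (simp add: algebra_simps)
  moreover have "fps_nonneg (fsum D * ((1 - q ^ 3) * parts_ge_2 (2 * n + 2)))"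
    by (rule fps_nonneg_mult[OF fps_nonneg_fsum[OF D]])
      (use fps_nonneg_parts_ge_2_Suc[of "2 * n + 1"] in simp)
  moreover have "fps_nonneg (fsum (\<lambda>k. (1 + q) * q ^ (r + 4) * D k + E k) * parts_ge_2 (2 * n + 2))"
    using fps_nonneg_parts_ge_2 D E
    by (intro fps_nonneg_mult fps_nonneg_fsum fps_nonneg_add) auto
  ultimately show ?thesis
    unfolding heine_difference by (simp only: fps_nonneg_add)
qed

section \<open>Comparison of the generating functions\<close>

definition rect_size :: "nat \<Rightarrow> nat \<Rightarrow> nat" where
  "rect_size m a = (a + 1) * (a + 1 + m)"

lemma rect_size_ge: "a \<le> rect_size m a"
  by (simp add: rect_size_def)

lemma rect_size_Suc: "rect_size m (Suc a) = rect_size m a + 2 * a + m + 3"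
  by (simp add: rect_size_def algebra_simps)

text \<open>The parameter \<open>a\<close> stands for an \<open>m\<close>-Durfee rectangle of \<open>a + 1 + m\<close> rows and \<open>a + 1\<close> columns.
  For a partition in \<open>Q - P\<close>, \<open>s\<close> counts the rows below the row of length \<open>a + 1\<close> which follows the rectangle;
  for one in \<open>P - Q\<close>, it is the number of columns to the right of the rectangle.\<close>
definition Q_gf :: "nat \<Rightarrow> nat \<Rightarrow> nat \<Rightarrow> int fps" where
  "Q_gf m a s = q ^ (rect_size m a + a + 1 + s) * (G s (m + a + 2) * G s (Suc a))"

definition P_gf :: "nat \<Rightarrow> nat \<Rightarrow> nat \<Rightarrow> int fps" where
  "P_gf m a s = q ^ (rect_size m a + s) * (G s (m + a + 1) * G s (Suc a))"

lemma P_gf_minus_Q_gf_nonneg: "fps_nonneg (fsum (\<lambda>a. fsum (P_gf m a) - fsum (Q_gf m a)))"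
proof -
  define e where "e = rect_size m"
  define P1 Q1 P2 Q2 where
    "P1 a s = q ^ (e a + s) * (G s (m + a + 1) * G s a)"
    and "Q1 a s = q ^ (e a + a + 1 + s) * (G s (m + a + 1) * G s (Suc a))"
    and "P2 a s = q ^ (e a + a + 2 * s + 2) * (G (Suc s) (m + a) * G s (Suc a))"
    and "Q2 a s = q ^ (e (Suc a) + 2 * s + 1) * (G s (m + a + 2) * G (Suc s) a)" for a s
  define P3 Q3 P4 Q4 where
    "P3 a s = q ^ (e a + a + 2 * s + 2) * (G (Suc s) (m + a) * G s a)"
    and "Q3 a s = q ^ (e (Suc a) + 2 * s + m + a + 4) * (G s (m + a + 2) * G (s + 2) a)"
    and "P4 a s = q ^ (e a + 2 * a + 2 * s + 4) * (G (s + 2) (m + a) * G s (Suc a))"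
    and "Q4 a s = q ^ (e (Suc a) + 2 * s + 1) * (G s (Suc (m + a)) * G (Suc s) a)" for a s
  note defs = P1_def Q1_def P2_def Q2_def P3_def Q3_def P4_def Q4_def P_gf_def Q_gf_def e_def[symmetric]
  have e_Suc: "e (Suc a) = e a + 2 * a + m + 3" for a
    by (simp add: e_def rect_size_Suc)
  have e_ge: "a \<le> e a" for a
    by (simp add: e_def rect_size_ge)
  have small: "fps_small (P_gf m a)" "fps_small (Q_gf m a)" "fps_small (P1 a)" "fps_small (Q1 a)"
    "fps_small (P2 a)" "fps_small (Q2 a)" "fps_small (P3 a)" "fps_small (Q3 a)"
    "fps_small (P4 a)" "fps_small (Q4 a)" for a
    unfolding defs by (rule fps_smallI, rule refl, simp)+
  have G_rec: "G (Suc s) (Suc c) = G (Suc s) c + q ^ c * G s (Suc c)"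
    "G (Suc s) (Suc c) = G s (Suc c) + q ^ Suc s * G (Suc s) c" for s c
    by (rule G.simps, rule G_Suc')

  \<comment> \<open>Splitting by extremal rows, \<open>Q1\<close> cancels within each \<open>a\<close>, and \<open>P1\<close> telescopes over \<open>a\<close>.\<close>
  have P: "fsum (P_gf m a) = fsum (P1 a) + fsum (Q1 a) + fsum (P2 a)" for a
  proof -
    have "P_gf m a (Suc s) = P1 a (Suc s) + Q1 a s + P2 a s" for s
    proof -
      have "G (Suc s) (m + a + 1) * G (Suc s) (Suc a)
          = G (Suc s) (m + a + 1) * G (Suc s) a
            + q ^ a * (G s (m + a + 1) + q ^ Suc s * G (Suc s) (m + a)) * G s (Suc a)"
        using G_rec(1)[of s a] G_rec(2)[of s "m + a"] by (simp add: algebra_simps)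
      then show ?thesis
        by (simp add: defs) (simp add: algebra_simps qpow eval_nat_numeral)
    qed
    moreover have "P_gf m a 0 = P1 a 0" by (simp add: defs)
    ultimately show ?thesis
      by (simp add: fsum_Suc[OF small(1)] fsum_Suc[OF small(3)] fsum_add)
  qed
  have Q: "fsum (Q_gf m a) = fsum (Q1 a) + fsum (P1 (Suc a)) + fsum (Q2 a)" for a
  proof -
    have "Q_gf m a (Suc s) = Q1 a (Suc s) + P1 (Suc a) s + Q2 a s" for s
    proof -
      have "G (Suc s) (m + a + 2) * G (Suc s) (Suc a)
          = G (Suc s) (m + a + 1) * G (Suc s) (Suc a)
            + q ^ (m + a + 1) * G s (m + a + 2) * (G s (Suc a) + q ^ Suc s * G (Suc s) a)"
        using G_rec(1)[of s "m + a + 1"] G_rec(2)[of s a] by (simp add: algebra_simps)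
      then show ?thesis
        by (simp add: defs e_Suc) (simp add: algebra_simps qpow power2_eq_square eval_nat_numeral)
    qed
    moreover have "Q_gf m a 0 = Q1 a 0" by (simp add: defs)
    ultimately show ?thesis
      by (simp add: fsum_Suc[OF small(2)] fsum_Suc[OF small(4)] fsum_add)
  qed
  \<comment> \<open>A second use of Pascal's rule, on one factor only, yields the pieces to be
    compared: P4 with Q4 at the same a, and P3 at a + 1 with Q3 at a.\<close>
  have P2: "fsum (P2 a) = fsum (P3 a) + fsum (P4 a)" for a
  proof -
    have "P2 a (Suc s) = P3 a (Suc s) + P4 a s" for s
      using G_rec(1)[of s a] by (simp add: defs) (simp add: algebra_simps qpow eval_nat_numeral)
    moreover have "P2 a 0 = P3 a 0" by (simp add: defs)
    ultimately show ?thesis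
      by (simp add: fsum_Suc[OF small(5)] fsum_Suc[OF small(7)] fsum_add)
  qed
  have Q2: "fsum (Q2 a) = fsum (Q4 a) + fsum (Q3 a)" for a
  proof -
    have "Q2 a (Suc s) = Q4 a (Suc s) + Q3 a s" for s
      using G_rec(1)[of s "m + a + 1"] by (simp add: defs) (simp add: algebra_simps qpow eval_nat_numeral)
    moreover have "Q2 a 0 = Q4 a 0" by (simp add: defs)
    ultimately show ?thesis
      by (simp add: fsum_Suc[OF small(6)] fsum_Suc[OF small(10)] fsum_add)
  qed

  have P4_Q4: "fps_nonneg (fsum (P4 a) - fsum (Q4 a))" for a
  proof -
    have "P4 a s - Q4 a s = q ^ (e a + 2 * a + 2 * s + 4)
        * (G (Suc (Suc s)) (m + a) * G s (Suc a) - q ^ m * (G s (Suc (m + a)) * G (Suc s) a))" for s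
      by (simp add: defs e_Suc) (simp add: algebra_simps qpow power2_eq_square eval_nat_numeral)
    thus ?thesis
      unfolding fsum_diff[symmetric]
      by (auto intro!: fps_nonneg_fsum fps_nonneg_mult G_exchange)
  qed
  \<comment> \<open>Both series contain \<open>q ^ e (Suc a)\<close>, which dictates the shift in a.
    For m >= 1, s is shifted as well, leaving the nonnegative term
    \<open>P3 (Suc a) 0\<close>.\<close>
  have P3_Q3: "fps_nonneg (fsum (P3 (Suc a)) - fsum (Q3 a))" for a
  proof (cases m)
    case (Suc l)
    have "P3 (Suc a) (Suc s) - Q3 a s = q ^ (e (Suc a) + 2 * s + a + 5)
        * (G (Suc (Suc s)) (Suc (Suc l + a)) * G (Suc s) (Suc a)
          - q ^ l * (G s (Suc (Suc (Suc l + a))) * G (Suc (Suc s)) a))" for s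
      by (simp add: defs Suc) (simp add: algebra_simps qpow power2_eq_square eval_nat_numeral)
    hence "fps_nonneg (fsum (\<lambda>s. P3 (Suc a) (Suc s) - Q3 a s))"
      using G_exchange'[of _ l a] by (auto intro!: fps_nonneg_fsum fps_nonneg_mult)
    moreover have "fps_nonneg (P3 (Suc a) 0)"
      by (simp add: defs fps_nonneg_mult)
    ultimately show ?thesis
      by (simp only: fsum_Suc[OF small(7)] fsum_diff add_diff_eq[symmetric] fps_nonneg_add)
  next
    case 0
    show ?thesis
    proof (cases a)
      case a0: 0
      \<comment> \<open>The factor \<open>G (s + 2) 0\<close> vanishes. For a > 0,
        \<open>heine_difference_nonneg\<close> applies with n = a - 1.\<close>
      have "Q3 a s = 0" for s by (simp add: defs a0)
      then have "fsum (P3 (Suc a)) - fsum (Q3 a) = fsum (\<lambda>s. P3 (Suc a) s)"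
        by (simp flip: fsum_diff)
      then show ?thesis
        by (auto simp: defs intro!: fps_nonneg_fsum fps_nonneg_mult)
    next
      case n: (Suc n)
      have "P3 (Suc a) s - Q3 a s = q ^ (e (Suc a) + a + 3)
          * (q ^ (2 * s) * (G (Suc s) (n + 2) * G s (n + 2) - q * (G s (n + 3) * G (s + 2) (n + 1))))" for s
        by (simp add: defs 0 n) (simp add: algebra_simps qpow eval_nat_numeral)
      moreover have "fps_small (\<lambda>s. q ^ (2 * s)
          * (G (Suc s) (n + 2) * G s (n + 2) - q * (G s (n + 3) * G (s + 2) (n + 1))))"
        by (rule fps_smallI, rule refl, simp)
      ultimately have "fsum (P3 (Suc a)) - fsum (Q3 a) = q ^ (e (Suc a) + a + 3) * fsum (\<lambda>s. q ^ (2 * s)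
          * (G (Suc s) (n + 2) * G s (n + 2) - q * (G s (n + 3) * G (s + 2) (n + 1))))"
        by (simp only: fsum_diff[symmetric] fsum_cmult)
      then show ?thesis
        by (simp only:) (intro fps_nonneg_mult heine_difference_nonneg fps_nonneg_power fps_nonneg_X)
    qed
  qed

  have small_nested: "fps_small (\<lambda>a. fsum (P1 a))" "fps_small (\<lambda>a. fsum (P3 a))"
  proof -
    have "fsum (P1 a) = q ^ e a * fsum (\<lambda>s. q ^ s * (G s (m + a + 1) * G s a))" for a
      by (subst fsum_cmult[symmetric], rule fps_smallI, rule refl, simp)
        (rule arg_cong[where f = fsum], rule ext, simp add: defs power_add mult.assoc)
    thus "fps_small (\<lambda>a. fsum (P1 a))"
      by (rule fps_smallI) (rule e_ge)
    have "fsum (P3 a) = q ^ e a * fsum (\<lambda>s. q ^ (a + 2 * s + 2) * (G (Suc s) (m + a) * G s a))" for a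
      by (subst fsum_cmult[symmetric], rule fps_smallI, rule refl, simp)
        (rule arg_cong[where f = fsum], rule ext, simp add: defs power_add mult.assoc)
    thus "fps_small (\<lambda>a. fsum (P3 a))"
      by (rule fps_smallI) (rule e_ge)
  qed
  have nonneg: "fps_nonneg (fsum (P1 0))" "fps_nonneg (fsum (P3 0))"
    by (auto simp: defs intro!: fps_nonneg_fsum fps_nonneg_mult)
  have "(\<lambda>a. fsum (P_gf m a) - fsum (Q_gf m a))
      = (\<lambda>a. fsum (P1 a) - fsum (P1 (Suc a)) + (fsum (P3 a) - fsum (Q3 a)) + (fsum (P4 a) - fsum (Q4 a)))"
    unfolding P Q P2 Q2 by (simp add: algebra_simps)
  hence "fsum (\<lambda>a. fsum (P_gf m a) - fsum (Q_gf m a))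
      = (fsum (\<lambda>a. fsum (P1 a)) - fsum (\<lambda>a. fsum (P1 (Suc a))))
        + (fsum (\<lambda>a. fsum (P3 a)) - fsum (\<lambda>a. fsum (Q3 a))) + fsum (\<lambda>a. fsum (P4 a) - fsum (Q4 a))"
    by (simp only: fsum_add fsum_diff)
  also have "\<dots> = fsum (P1 0) + (fsum (P3 0) + fsum (\<lambda>a. fsum (P3 (Suc a)) - fsum (Q3 a)))
        + fsum (\<lambda>a. fsum (P4 a) - fsum (Q4 a))"
    by (simp add: fsum_Suc[OF small_nested(1)] fsum_Suc[OF small_nested(2)] fsum_diff)
  finally show ?thesis
    using fps_nonneg_add[OF fps_nonneg_add[OF nonneg(1) fps_nonneg_add[OF nonneg(2)
      fps_nonneg_fsum[OF P3_Q3]]] fps_nonneg_fsum[OF P4_Q4]] by (simp only:)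
qed

section \<open>Partitions and their Durfee rectangles\<close>

definition boxed :: "nat \<Rightarrow> nat \<Rightarrow> nat list set" where
  "boxed s c = {xs. length xs = s \<and> sorted_wrt (\<ge>) xs \<and> (\<forall>x\<in>set xs. x < c)}"

lemma finite_boxed [simp]: "finite (boxed s c)"
  by (rule finite_subset[OF _ finite_lists_length_eq[of "{..<c}" s]]) (auto simp: boxed_def)

lemma boxed_0 [simp]: "boxed 0 c = {[]}"
  and boxed_Suc_0 [simp]: "boxed (Suc s) 0 = {}"
  by (auto simp: boxed_def length_Suc_conv)

lemma boxed_Suc_Suc: "boxed (Suc s) (Suc c) = boxed (Suc s) c \<union> (#) c ` boxed s (Suc c)"
proof (intro equalityI subsetI)
  fix xs assume xs: "xs \<in> boxed (Suc s) (Suc c)"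
  then obtain y ys where y: "xs = y # ys" by (auto simp: boxed_def length_Suc_conv)
  show "xs \<in> boxed (Suc s) c \<union> (#) c ` boxed s (Suc c)"
  proof (cases "y = c")
    case True
    then show ?thesis using xs by (auto simp: boxed_def y)
  next
    case False
    then show ?thesis using xs by (fastforce simp: boxed_def y)
  qed
qed (auto simp: boxed_def less_Suc_eq_le)

lemma G_eq_sum_boxed: "G s c = (\<Sum>xs\<in>boxed s c. q ^ sum_list xs)"
proof (induction s c rule: G.induct)
  case (3 s c)
  have "boxed (Suc s) c \<inter> (#) c ` boxed s (Suc c) = {}"
    by (auto simp: boxed_def)
  then show ?case
    by (simp add: boxed_Suc_Suc sum.union_disjoint G.simps(3) 3 sum.reindex power_add sum_distrib_left)
qed simp_all

lemma nth_sum_X_power: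
  assumes "finite A"
  shows "(\<Sum>x\<in>A. q ^ w x) $ n = int (card {x \<in> A. w x = n})"
proof -
  have "(\<Sum>x\<in>A. q ^ w x) $ n = (\<Sum>x\<in>A. if w x = n then 1 else 0)"
    by (simp add: fps_sum_nth fps_X_power_nth eq_commute)
  also have "\<dots> = int (card {x \<in> A. w x = n})"
    using assms by (simp add: sum.If_cases Int_def)
  finally show ?thesis .
qed

definition box_pairs :: "nat \<Rightarrow> nat \<Rightarrow> nat \<Rightarrow> nat \<Rightarrow> nat \<Rightarrow> nat \<Rightarrow> (nat list \<times> nat list) set" where
  "box_pairs s c s' c' k n = {(xs, ys) \<in> boxed s c \<times> boxed s' c'. k + sum_list xs + sum_list ys = n}"

lemma finite_box_pairs [simp]: "finite (box_pairs s c s' c' k n)"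
  by (rule finite_subset[of _ "boxed s c \<times> boxed s' c'"]) (auto simp: box_pairs_def)

lemma card_box_pairs: "int (card (box_pairs s c s' c' k n)) = (q ^ k * (G s c * G s' c')) $ n"
proof -
  have "q ^ k * (G s c * G s' c')
      = (\<Sum>xs\<in>boxed s c. \<Sum>ys\<in>boxed s' c'. q ^ (k + sum_list xs + sum_list ys))"
    by (simp only: G_eq_sum_boxed sum_product) (simp only: sum_distrib_left power_add mult.assoc)
  also have "\<dots> = (\<Sum>p\<in>boxed s c \<times> boxed s' c'. q ^ (k + sum_list (fst p) + sum_list (snd p)))"
    by (simp add: sum.cartesian_product case_prod_beta)
  finally have "q ^ k * (G s c * G s' c') = \<dots>" .
  moreover have "{p \<in> boxed s c \<times> boxed s' c'. k + sum_list (fst p) + sum_list (snd p) = n} = box_pairs s c s' c' k n"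
    by (auto simp: box_pairs_def)
  ultimately show ?thesis
    by (simp add: nth_sum_X_power)
qed

lemma sum_list_map_add_const: "sum_list (map (\<lambda>x. x + c) xs) = sum_list xs + length xs * (c::nat)"
  by (induction xs) simp_all

lemma sum_list_filter_pos: "sum_list (filter (\<lambda>x. 0 < x) xs) = sum_list (xs :: nat list)"
  by (induction xs) auto

lemma finite_partitions: "finite (partitions n)"
proof (rule finite_subset)
  have "length xs \<le> sum_list xs" if "\<forall>x\<in>set xs. 0 < x" for xs :: "nat list"
    using that by (induction xs) auto
  moreover have "x \<le> sum_list xs" if "x \<in> set xs" for x and xs :: "nat list"
    using that by (simp add: member_le_sum_list)
  ultimately show "partitions n \<subseteq> {xs. set xs \<subseteq> {..n} \<and> length xs \<le> n}"
    by (auto simp: partitions_def is_partition_def)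
qed (simp add: finite_lists_length_le)

section \<open>Encoding of the two differences by a rectangle and two boxed partitions\<close>

definition Q_codes :: "nat \<Rightarrow> nat \<Rightarrow> (nat \<times> nat \<times> nat list \<times> nat list) set" where
  "Q_codes m n = (SIGMA a:{..n}. SIGMA s:{..n}.
    box_pairs (m + a + 1) (Suc s) s (Suc a) (rect_size m a + a + 1 + s) n)"

definition P_codes :: "nat \<Rightarrow> nat \<Rightarrow> (nat \<times> nat \<times> nat list \<times> nat list) set" where
  "P_codes m n = (SIGMA a:{..n}. SIGMA s:{..n}. box_pairs (m + a) (Suc s) s (Suc a) (rect_size m a + s) n)"

lemma finite_codes [simp]: "finite (Q_codes m n)" "finite (P_codes m n)"
  by (auto simp: Q_codes_def P_codes_def)

text \<open>The lists xs have length governed by m + a and entries at most s, whereas the generating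
  functions use the conjugate box; \<open>G_sym\<close> joins the two. The bounds a, s <= n are the
  truncations in \<open>fsum\<close>.\<close>

lemma card_codes_le: "card (Q_codes m n) \<le> card (P_codes m n)"
proof -
  have Q: "int (card (box_pairs (m + a + 1) (Suc s) s (Suc a) (rect_size m a + a + 1 + s) n)) = Q_gf m a s $ n" for a s
    by (simp only: card_box_pairs Q_gf_def G_sym[of "m + a + 1" s]) simp
  have P: "int (card (box_pairs (m + a) (Suc s) s (Suc a) (rect_size m a + s) n)) = P_gf m a s $ n" for a s
    by (simp only: card_box_pairs P_gf_def G_sym[of "m + a" s]) simp
  have "int (card (P_codes m n)) = (\<Sum>a\<le>n. \<Sum>s\<le>n. P_gf m a s $ n)"
    unfolding P_codes_def P[symmetric] by simp
  moreover have "int (card (Q_codes m n)) = (\<Sum>a\<le>n. \<Sum>s\<le>n. Q_gf m a s $ n)"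
    unfolding Q_codes_def Q[symmetric] by simp
  ultimately have "int (card (P_codes m n)) - int (card (Q_codes m n))
      = (\<Sum>a\<le>n. \<Sum>s\<le>n. P_gf m a s $ n) - (\<Sum>a\<le>n. \<Sum>s\<le>n. Q_gf m a s $ n)"
    by simp
  also have "\<dots> = fsum (\<lambda>a. fsum (P_gf m a) - fsum (Q_gf m a)) $ n"
    by (simp add: fsum_nth sum_subtractf)
  also have "\<dots> \<ge> 0"
    using P_gf_minus_Q_gf_nonneg by (simp add: fps_nonneg_def)
  finally show ?thesis by simp
qed

definition Q_decode :: "nat \<times> nat \<times> nat list \<times> nat list \<Rightarrow> nat list" where
  "Q_decode = (\<lambda>(a, s, xs, ys). map (\<lambda>x. x + (a + 1)) xs @ [a + 1] @ map (\<lambda>x. x + 1) ys)"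

definition P_decode :: "nat \<times> nat \<times> nat list \<times> nat list \<Rightarrow> nat list" where
  "P_decode = (\<lambda>(a, s, xs, ys). map (\<lambda>x. x + (a + 1)) (s # xs) @ filter (\<lambda>x. 0 < x) ys)"

lemma Q_minus_P_subset: "Q (int m) n - P (- int m) n \<subseteq> Q_decode ` Q_codes m n"
proof
  fix lam assume lam: "lam \<in> Q (int m) n - P (- int m) n"
  hence part: "sorted_wrt (\<ge>) lam" "\<forall>x\<in>set lam. 0 < x" "sum_list lam = n"
    and rank: "prank lam < - int m" and mem: "int m \<in> rank_set lam"
    by (auto simp: Q_def P_def partitions_def is_partition_def)
  have ne: "lam \<noteq> []" using rank by (auto simp: prank_def)
  have hd: "hd lam + m < length lam" using rank ne by (auto simp: prank_def)
  \<comment> \<open>The tail of the rank-set starts at \<open>length lam\<close>, which exceeds m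
    since the rank is below -m; hence m comes from a part.\<close>
  obtain i where i: "i < length lam" "int i - int (lam ! i) = int m"
    using mem hd by (auto simp: rank_set_def)
  define a where "a = lam ! i - 1"
  have "0 < lam ! i" using part(2) i(1) by auto
  hence a: "lam ! i = a + 1" "i = m + a + 1" using i(2) by (auto simp: a_def)
  define T D where "T = take i lam" and "D = drop (Suc i) lam"
  have split: "lam = T @ [a + 1] @ D"
    unfolding T_def D_def using id_take_nth_drop[OF i(1)] a(1) by simp
  have T: "a + 1 \<le> x \<and> x \<le> hd lam" if "x \<in> set T" for x
  proof -
    have "x \<in> set lam" using that unfolding T_def by (rule in_set_takeD)
    hence "x \<le> hd lam"
      using part(1) by (cases lam) auto
    moreover have "a + 1 \<le> x"
      using part(1) that by (subst (asm) split) (auto simp: sorted_wrt_append)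
    ultimately show ?thesis by simp
  qed
  have D: "1 \<le> x \<and> x \<le> a + 1" if "x \<in> set D" for x
    using part(1,2) that by (subst (asm) split, subst (asm) split) (auto simp: sorted_wrt_append Suc_le_eq)
  define s xs ys where "s = length D" and "xs = map (\<lambda>x. x - (a + 1)) T" and "ys = map (\<lambda>x. x - 1) D"
  have len: "length lam = m + a + 1 + 1 + s"
    using i(1) by (simp add: s_def D_def a(2))
  have sorted: "sorted_wrt (\<ge>) T" "sorted_wrt (\<ge>) D"
    using part(1) by (subst (asm) split, simp add: sorted_wrt_append)+
  have Ts: "T = map (\<lambda>x. x + (a + 1)) xs"
    unfolding xs_def map_map
    by (rule map_idI[symmetric]) (simp only: o_def le_add_diff_inverse2[OF T[THEN conjunct1]])
  have Ds: "D = map (\<lambda>x. x + 1) ys"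
    unfolding ys_def map_map
    by (rule map_idI[symmetric]) (simp only: o_def le_add_diff_inverse2[OF D[THEN conjunct1]])
  have "sorted_wrt (\<ge>) xs" "sorted_wrt (\<ge>) ys"
    unfolding xs_def ys_def sorted_wrt_map
    by (rule sorted_wrt_mono_rel[OF _ sorted(1)], simp, rule sorted_wrt_mono_rel[OF _ sorted(2)], simp)
  \<comment> \<open>This is the rank condition: hd lam + m < length lam = m + a + 2 + s says that
    the largest part exceeds a + 1 by at most s.\<close>
  moreover have "\<forall>x\<in>set xs. x < Suc s"
  proof
    fix x assume "x \<in> set xs"
    then obtain t where "t \<in> set T" "x = t - (a + 1)" by (auto simp: xs_def)
    then show "x < Suc s" using T[of t] hd len by linarith
  qed
  moreover have "\<forall>y\<in>set ys. y < Suc a"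
  proof
    fix y assume "y \<in> set ys"
    then obtain t where "t \<in> set D" "y = t - 1" by (auto simp: ys_def)
    then show "y < Suc a" using D[of t] by linarith
  qed
  moreover have "length xs = m + a + 1" "length ys = s"
    using i(1) a(2) by (simp_all add: xs_def ys_def s_def T_def)
  ultimately have xs: "xs \<in> boxed (m + a + 1) (Suc s)" and ys: "ys \<in> boxed s (Suc a)"
    by (auto simp: boxed_def)
  have lenx: "length xs = m + a + 1" and leny: "length ys = s"
    using xs ys by (auto simp: boxed_def)
  have "n = sum_list T + (a + 1) + sum_list D"
    using part(3) by (subst (asm) split) simp
  hence n: "n = rect_size m a + a + 1 + s + sum_list xs + sum_list ys"
    unfolding Ts Ds sum_list_map_add_const lenx leny by (simp add: rect_size_def algebra_simps)
  hence "(a, s, xs, ys) \<in> Q_codes m n"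
    using xs ys by (auto simp: Q_codes_def box_pairs_def)
  moreover have "lam = Q_decode (a, s, xs, ys)"
    using split Ts Ds by (simp add: Q_decode_def)
  ultimately show "lam \<in> Q_decode ` Q_codes m n" by blast
qed

lemma P_decode_in:
  assumes "(a, s, xs, ys) \<in> P_codes m n"
  shows "P_decode (a, s, xs, ys) \<in> P (- int m) n - Q (int m) n"
proof -
  have xs: "length xs = m + a" "sorted_wrt (\<ge>) xs" "\<forall>x\<in>set xs. x \<le> s"
    and ys: "length ys = s" "sorted_wrt (\<ge>) ys" "\<forall>y\<in>set ys. y \<le> a"
    and n: "rect_size m a + s + sum_list xs + sum_list ys = n"
    using assms by (auto simp: P_codes_def box_pairs_def boxed_def less_Suc_eq_le)
  define H T where "H = map (\<lambda>x. x + (a + 1)) (s # xs)" and "T = filter (\<lambda>x. 0 < x) ys"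
  have lam: "P_decode (a, s, xs, ys) = H @ T" by (simp add: P_decode_def H_def T_def)
  have H: "length H = m + a + 1" "\<And>x. x \<in> set H \<Longrightarrow> a + 1 \<le> x"
    using xs by (auto simp: H_def)
  have T: "length T \<le> s" "\<And>x. x \<in> set T \<Longrightarrow> 0 < x \<and> x \<le> a"
    using ys by (auto simp: T_def intro: order_trans[OF length_filter_le])
  have "sorted_wrt (\<ge>) (s # xs)" using xs by simp
  hence "sorted_wrt (\<ge>) H"
    unfolding H_def sorted_wrt_map by (rule sorted_wrt_mono_rel[rotated]) simp
  moreover have "sorted_wrt (\<ge>) T"
    unfolding T_def by (rule sorted_wrt_filter[OF ys(2)])
  moreover have "y \<le> x" if "x \<in> set H" "y \<in> set T" for x y
    using H(2)[OF that(1)] T(2)[OF that(2)] by linarith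
  ultimately have "sorted_wrt (\<ge>) (H @ T)"
    by (simp add: sorted_wrt_append)
  moreover have "\<forall>x\<in>set (H @ T). 0 < x" using H(2) T(2) by fastforce
  moreover have "sum_list (H @ T) = n"
    unfolding H_def T_def sum_list_append sum_list_map_add_const sum_list_filter_pos
    using n xs(1) by (simp add: rect_size_def algebra_simps)
  ultimately have part: "H @ T \<in> partitions n" by (simp add: partitions_def is_partition_def)
  have "prank (H @ T) \<ge> - int m"
    using T(1) H(1) by (simp add: prank_def) (simp add: H_def xs(1))
  \<comment> \<open>The entry at i is below m inside the rectangle, where i <= m + a and the part is
    at least a + 1. It is above m afterwards, where i >= m + a + 1 and the part is at most
    a.\<close>
  moreover have "int m \<notin> rank_set (H @ T)"
  proof -
    have "int i - int ((H @ T) ! i) \<noteq> int m" if "i < length (H @ T)" for i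
    proof (cases "i < m + a + 1")
      case True
      hence "a + 1 \<le> (H @ T) ! i" using H nth_mem[of i H] by (simp add: nth_append)
      then show ?thesis using True by simp
    next
      case False
      hence "(H @ T) ! i \<le> a"
        using H T(2) nth_mem[of "i - (m + a + 1)" T] that by (simp add: nth_append)
      then show ?thesis using False by simp
    qed
    moreover have "\<not> length (H @ T) \<le> m" using H(1) by simp
    ultimately show ?thesis unfolding rank_set_def by fastforce
  qed
  ultimately show ?thesis using part by (simp add: lam P_def Q_def)
qed

lemma filter_pos_append_replicate:
  "sorted_wrt (\<ge>) ys \<Longrightarrow>
    ys = filter (\<lambda>y. 0 < y) ys @ replicate (length ys - length (filter (\<lambda>y. 0 < y) ys)) (0 :: nat)"
proof (induction ys)
  case (Cons y ys)
  show ?case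
  proof (cases "y = 0")
    case True
    hence "\<forall>x\<in>set (y # ys). x = 0" using Cons.prems by auto
    hence "filter (\<lambda>y. 0 < y) (y # ys) = []" "y # ys = replicate (length (y # ys)) 0"
      by (auto simp: filter_empty_conv intro!: replicate_eqI)
    then show ?thesis by simp
  next
    case False
    then show ?thesis using Cons by simp
  qed
qed simp

text \<open>The number of parts of size at least a + 1 is m + a + 1. As a grows, that number cannot
  increase while m + a + 1 does, so a is determined. The first part then gives s, and s gives the
  number of zeros missing from ys.\<close>

lemma inj_on_P_decode: "inj_on P_decode (P_codes m n)"
proof (rule inj_onI)
  fix c c' assume c: "c \<in> P_codes m n" "c' \<in> P_codes m n" "P_decode c = P_decode c'"
  obtain a s xs ys a' s' xs' ys' where c_eq: "c = (a, s, xs, ys)" "c' = (a', s', xs', ys')"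
    by (metis prod_cases4)
  note mem = c(1,2)[unfolded c_eq] and eq = c(3)[unfolded c_eq]
  have code: "length xs = m + a \<and> length ys = s \<and> sorted_wrt (\<ge>) ys
      \<and> filter (\<lambda>x. a + 1 \<le> x) (P_decode (a, s, xs, ys)) = map (\<lambda>x. x + (a + 1)) (s # xs)
      \<and> filter (\<lambda>x. \<not> a + 1 \<le> x) (P_decode (a, s, xs, ys)) = filter (\<lambda>x. 0 < x) ys"
    if "(a, s, xs, ys) \<in> P_codes m n" for a s xs ys
  proof -
    have *: "length xs = m + a" "length ys = s" "sorted_wrt (\<ge>) ys" "\<forall>y\<in>set ys. y \<le> a"
      using that by (auto simp: P_codes_def box_pairs_def boxed_def)
    have "filter (\<lambda>x. 0 < x \<and> Suc a \<le> x) ys = []"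
      "filter (\<lambda>x. 0 < x \<and> \<not> Suc a \<le> x) ys = filter (\<lambda>x. 0 < x) ys"
      using *(4) by (force simp: filter_empty_conv intro: filter_cong)+
    then show ?thesis using * by (auto simp: P_decode_def filter_map o_def)
  qed
  define lam where "lam = P_decode (a, s, xs, ys)"
  have len: "length (filter (\<lambda>x. a + 1 \<le> x) lam) = m + a + 1" "length (filter (\<lambda>x. a' + 1 \<le> x) lam) = m + a' + 1"
    using code[OF mem(1)] code[OF mem(2)] eq by (simp_all add: lam_def)
  have anti: "length (filter (\<lambda>x. u \<le> x) lam) \<le> length (filter (\<lambda>x. t \<le> x) lam)" if "t \<le> u" for t u
    using that by (induction lam) auto
  have a: "a' = a"
    using len anti[of "a + 1" "a' + 1"] anti[of "a' + 1" "a + 1"] by linarith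
  have "map (\<lambda>x. x + (a + 1)) (s # xs) = map (\<lambda>x. x + (a + 1)) (s' # xs')"
    and fil: "filter (\<lambda>x. 0 < x) ys = filter (\<lambda>x. 0 < x) ys'"
    using code[OF mem(1)] code[OF mem(2)] eq unfolding a by metis+
  hence "s # xs = s' # xs'"
    by (metis (no_types, lifting) add_right_cancel inj_map_eq_map inj_onI)
  moreover from this have "ys = ys'"
    using filter_pos_append_replicate[of ys] filter_pos_append_replicate[of ys']
      code[OF mem(1)] code[OF mem(2)] fil by (metis list.inject)
  ultimately show "c = c'" using a c_eq by simp
qed

theorem theorem4p1:
  fixes m :: int and n :: nat
  assumes "0 \<le> m" and "1 \<le> n"
  shows "\<exists>f. inj_on f (Q m n) \<and> f ` Q m n \<subseteq> P (-m) n"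
proof -
  obtain k where k: "m = int k" using assms(1) nonneg_int_cases by blast
  have fin: "finite (Q m n)" "finite (P (- m) n)"
    using finite_partitions by (auto simp: Q_def P_def)
  have "card (Q m n - P (- m) n) \<le> card (Q_decode ` Q_codes k n)"
    unfolding k by (rule card_mono[OF _ Q_minus_P_subset]) simp
  also have "\<dots> \<le> card (Q_codes k n)" by (rule card_image_le) simp
  also have "\<dots> \<le> card (P_codes k n)" by (rule card_codes_le)
  also have "\<dots> = card (P_decode ` P_codes k n)" by (rule card_image[OF inj_on_P_decode, symmetric])
  also have "\<dots> \<le> card (P (- m) n - Q m n)"
    unfolding k by (rule card_mono) (use P_decode_in fin k in auto)
  finally have "card (Q m n) - card (Q m n \<inter> P (- m) n) \<le> card (P (- m) n) - card (Q m n \<inter> P (- m) n)"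
    using fin by (simp add: card_Diff_subset_Int Int_commute)
  moreover have "card (Q m n \<inter> P (- m) n) \<le> card (P (- m) n)"
    using fin by (intro card_mono) auto
  ultimately have "card (Q m n) \<le> card (P (- m) n)"
    by linarith
  thus ?thesis using card_le_inj[OF fin] by blast
qed

end
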